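(* Let $H$ be a complex Hilbert space and let $A, A_1, A_2, \ldots$ be self-adjoint graphs in $H$ which are uniformly bounded below. If $\lim_{n \to \infty} A_n = A$ in the strong resolvent sense, then $\lim_{n \to \infty} e^{-tA_n} = e^{-tA}$ strongly for all $t > 0$. Likewise, if $\lim_{n \to \infty} (A_n + isI)^{-1} = (A + isI)^{-1}$ in the operator norm of $\mathcal{L}(H)$ for all $s \in \mathbb{R} \setminus \{0\}$, then $\lim_{n \to \infty} e^{-tA_n} = e^{-tA}$ in the operator norm of $\mathcal{L}(H)$ for all $t > 0$.
   Context: A graph in $H$ is a linear subspace $A$ of $H \times H$. For $\lambda \in \mathbb{C}$, $A + \lambda I := \{(x,y+\lambda x) : (x,y) \in A\}$; a graph is invertible if it is closed and for every $y \in H$ there is exactly one $x$ with $(x,y)$ in the graph, and then its inverse is the bounded operator $y \mapsto x$. A graph $A$ is self-adjoint if $(x,y)_H \in \mathbb{R}$ for all $(x,y) \in A$ and $A + isI$ is surjective for all $s \in \mathbb{R}\setminus\{0\}$; then $A + isI$ is invertible for all such $s$. Self-adjoint graphs $A, A_1, A_2, \ldots$ are uniformly bounded below if there exists $\omega \in \mathbb{R}$ such that $(x,y)_H + \omega\|x\|_H^2 \geq 0$ for all $(x,y)$ in any of the graphs $A, A_1, A_2, \ldots$. For self-adjoint graphs, $\lim A_n = A$ in the strong resolvent sense means that $(A_n + isI)^{-1} \to (A+isI)^{-1}$ strongly for one (equivalently, all) $s \in \mathbb{R} \setminus \{0\}$. For a self-adjoint graph $A$ which is bounded below, and $t > 0$,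 one defines $$e^{-tA} = \lim_{n \to \infty} \Big( (I + \tfrac{t}{n} A)^{-1} \Big)^n ,$$ where $I + \tfrac{t}{n}A = \{(x, x + \tfrac{t}{n} y) : (x,y) \in A\}$ is invertible for all large $n$. Equivalently, with $A(0) = \{y : (0,y) \in A\}$ and the decomposition $H = A(0) \oplus A(0)^\perp$, one has $e^{-tA} = 0 \oplus e^{-tA^\circ}$, where $A^\circ$ is the self-adjoint operator in $A(0)^\perp$ whose graph is $A \cap (A(0)^\perp \times A(0)^\perp)$. *)

theory Defs
  imports "HOL-Analysis.Analysis"
begin

text \<open>Complex Hilbert spaces are not in the distribution. They are introduced here on top of
  the real classes, so that the library's norm, topology and bounded operators apply. The inner
  product is linear in its first argument.\<close>

class complex_vector = real_vector +
  fixes scaleC :: "complex \<Rightarrow> 'a \<Rightarrow> 'a" (infixr "*\<^sub>C" 75)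
  assumes scaleC_add_right: "a *\<^sub>C (x + y) = a *\<^sub>C x + a *\<^sub>C y"
    and scaleC_add_left: "(a + b) *\<^sub>C x = a *\<^sub>C x + b *\<^sub>C x"
    and scaleC_scaleC: "a *\<^sub>C b *\<^sub>C x = (a * b) *\<^sub>C x"
    and scaleC_one: "1 *\<^sub>C x = x"
    and scaleR_scaleC: "r *\<^sub>R x = complex_of_real r *\<^sub>C x"

class complex_inner = complex_vector + real_normed_vector +
  fixes cinner :: "'a \<Rightarrow> 'a \<Rightarrow> complex"
  assumes cinner_commute: "cinner x y = cnj (cinner y x)"
    and cinner_add_left: "cinner (x + y) z = cinner x z + cinner y z"
    and cinner_scaleC_left: "cinner (a *\<^sub>C x) y = a * cinner x y"
    and cinner_ge_zero: "0 \<le> Re (cinner x x)"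
    and cinner_eq_zero_iff: "cinner x x = 0 \<longleftrightarrow> x = 0"
    and norm_eq_sqrt_cinner: "norm x = sqrt (Re (cinner x x))"

class chilbert_space = complex_inner + complete_space

instantiation prod :: (complex_vector, complex_vector) complex_vector
begin

definition scaleC_prod_def: "c *\<^sub>C p = (c *\<^sub>C fst p, c *\<^sub>C snd p)"

instance
  by standard
    (auto simp: scaleC_prod_def scaleR_prod_def scaleC_add_right scaleC_add_left scaleC_scaleC
      scaleC_one scaleR_scaleC)

end

instantiation complex :: chilbert_space
begin

definition scaleC_complex_def: "c *\<^sub>C (x::complex) = c * x"
definition cinner_complex_def: "cinner x y = x * cnj y"

instance
proof
  fix x :: complex
  show "norm x = sqrt (Re (cinner x x))"
    by (simp add: cinner_complex_def cmod_def power2_eq_square)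
qed (simp_all add: scaleC_complex_def cinner_complex_def distrib_left distrib_right
    scaleR_conv_of_real mult_ac)

end

definition csubspace :: "'a::complex_vector set \<Rightarrow> bool" where
  "csubspace S \<longleftrightarrow>
     0 \<in> S \<and> (\<forall>x\<in>S. \<forall>y\<in>S. x + y \<in> S) \<and> (\<forall>c. \<forall>x\<in>S. c *\<^sub>C x \<in> S)"

definition bounded_clinear :: "('a \<Rightarrow> 'a::complex_inner) \<Rightarrow> bool" where
  "bounded_clinear T \<longleftrightarrow> bounded_linear T \<and> (\<forall>c x. T (c *\<^sub>C x) = c *\<^sub>C T x)"

text \<open>Convergence of sequences in \<open>\<L>(H)\<close>. Membership in \<open>\<L>(H)\<close> is part of both notions; in
  particular \<open>onorm\<close> is only ever applied to bounded operators. For the resolvents below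
  membership is automatic, see \<open>self_adjoint_resolvent\<close>.\<close>

definition strongly_tendsto ::
    "(nat \<Rightarrow> 'a \<Rightarrow> 'a) \<Rightarrow> ('a \<Rightarrow> 'a::complex_inner) \<Rightarrow> bool" where
  "strongly_tendsto T L \<longleftrightarrow> (\<forall>n. bounded_clinear (T n)) \<and> bounded_clinear L \<and>
     (\<forall>x. (\<lambda>n. T n x) \<longlonglongrightarrow> L x)"

definition norm_tendsto ::
    "(nat \<Rightarrow> 'a \<Rightarrow> 'a) \<Rightarrow> ('a \<Rightarrow> 'a::complex_inner) \<Rightarrow> bool" where
  "norm_tendsto T L \<longleftrightarrow> (\<forall>n. bounded_clinear (T n)) \<and> bounded_clinear L \<and>
     (\<lambda>n. onorm (\<lambda>x. T n x - L x)) \<longlonglongrightarrow> 0"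

definition graph_shift :: "('a::complex_inner \<times> 'a) set \<Rightarrow> complex \<Rightarrow> ('a \<times> 'a) set" where
  "graph_shift A c = {(x, y + c *\<^sub>C x) | x y. (x, y) \<in> A}"

definition one_plus_graph :: "real \<Rightarrow> ('a::complex_inner \<times> 'a) set \<Rightarrow> ('a \<times> 'a) set" where
  "one_plus_graph r A = {(x, x + r *\<^sub>R y) | x y. (x, y) \<in> A}"

definition graph_invertible :: "('a::complex_inner \<times> 'a) set \<Rightarrow> bool" where
  "graph_invertible A \<longleftrightarrow> csubspace A \<and> closed A \<and> (\<forall>y. \<exists>!x. (x, y) \<in> A)"

text \<open>Meaningful only if \<open>graph_invertible A\<close>.\<close>

definition graph_inverse :: "('a::complex_inner \<times> 'a) set \<Rightarrow> 'a \<Rightarrow> 'a" where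
  "graph_inverse A y = (THE x. (x, y) \<in> A)"

definition self_adjoint_graph :: "('a::complex_inner \<times> 'a) set \<Rightarrow> bool" where
  "self_adjoint_graph A \<longleftrightarrow> csubspace A \<and> (\<forall>(x, y)\<in>A. cinner x y \<in> \<real>) \<and>
     (\<forall>s::real. s \<noteq> 0 \<longrightarrow> Range (graph_shift A (\<i> * complex_of_real s)) = UNIV)"

text \<open>For self-adjoint graphs \<open>cinner x y\<close> is real, so taking the real part loses nothing.\<close>

definition uniformly_bounded_below :: "('a::complex_inner \<times> 'a) set set \<Rightarrow> bool" where
  "uniformly_bounded_below \<A> \<longleftrightarrow>
     (\<exists>\<omega>::real. \<forall>A\<in>\<A>. \<forall>(x, y)\<in>A. Re (cinner x y) + \<omega> * (norm x)\<^sup>2 \<ge> 0)"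

text \<open>\<open>resolvent_at A s\<close> is \<open>(A + i s I)\<^sup>-\<^sup>1\<close>.\<close>

definition resolvent_at :: "('a::complex_inner \<times> 'a) set \<Rightarrow> real \<Rightarrow> 'a \<Rightarrow> 'a" where
  "resolvent_at A s = graph_inverse (graph_shift A (\<i> * complex_of_real s))"

text \<open>Convergence for one \<open>s\<close> is equivalent to convergence for all \<open>s\<close>; the formally weaker
  condition is taken as the definition.\<close>

definition strong_resolvent_tendsto ::
    "(nat \<Rightarrow> ('a::complex_inner \<times> 'a) set) \<Rightarrow> ('a \<times> 'a) set \<Rightarrow> bool" where
  "strong_resolvent_tendsto An A \<longleftrightarrow>
     (\<exists>s. s \<noteq> 0 \<and> strongly_tendsto (\<lambda>n. resolvent_at (An n) s) (resolvent_at A s))"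

text \<open>\<open>graph_exp t A\<close> is \<open>e\<^sup>-\<^sup>t\<^sup>A\<close>; the limit is taken in the strong sense.\<close>

definition graph_exp :: "real \<Rightarrow> ('a::complex_inner \<times> 'a) set \<Rightarrow> 'a \<Rightarrow> 'a" where
  "graph_exp t A x = lim (\<lambda>n. (graph_inverse (one_plus_graph (t / real n) A) ^^ n) x)"

context
begin

private lemma cinner_add_right: "cinner x (y + z) = cinner x y + cinner x (z::'a::complex_inner)"
  by (metis cinner_commute cinner_add_left complex_cnj_add)

private lemma cinner_scaleC_right: "cinner x (a *\<^sub>C y) = cnj a * cinner x (y::'a::complex_inner)"
  by (metis cinner_commute cinner_scaleC_left complex_cnj_mult)

private lemma norm_sq: "(norm x)\<^sup>2 = Re (cinner x (x::'a::complex_inner))"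
  by (simp add: norm_eq_sqrt_cinner cinner_ge_zero)

private lemma cinner_self: "cinner x x = complex_of_real ((norm (x::'a::complex_inner))\<^sup>2)"
proof -
  have "Im (cinner x x) = 0"
    using arg_cong[where f = Im, OF cinner_commute[of x x]] by simp
  then show ?thesis by (simp add: complex_eq_iff norm_sq)
qed

private lemma shift_norm:
  assumes "cinner x y \<in> \<real>"
  shows "(norm (y + (\<i> * complex_of_real s) *\<^sub>C (x::'a::complex_inner)))\<^sup>2
    = (norm y)\<^sup>2 + s\<^sup>2 * (norm x)\<^sup>2"
proof -
  obtain r where r: "cinner x y = complex_of_real r" using assms by (auto elim: Reals_cases)
  then have r': "cinner y x = complex_of_real r" by (metis cinner_commute complex_cnj_complex_of_real)
  have "cinner (y + (\<i> * complex_of_real s) *\<^sub>C x) (y + (\<i> * complex_of_real s) *\<^sub>C x)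
      = complex_of_real ((norm y)\<^sup>2 + s\<^sup>2 * (norm x)\<^sup>2)"
    unfolding cinner_add_left cinner_add_right cinner_scaleC_left cinner_scaleC_right r r'
      cinner_self[of x] cinner_self[of y]
    by (simp add: complex_eq_iff power2_eq_square)
  then show ?thesis unfolding cinner_self[of "y + _"] of_real_eq_iff .
qed

private lemma csubspace_shift:
  assumes "csubspace A"
  shows "csubspace (graph_shift A c)"
proof -
  have z: "(0, 0) \<in> A" and a: "\<And>x y u v. (x,y) \<in> A \<Longrightarrow> (u,v) \<in> A \<Longrightarrow> (x+u,y+v) \<in> A"
    and m: "\<And>d x y. (x,y) \<in> A \<Longrightarrow> (d *\<^sub>C x, d *\<^sub>C y) \<in> A"
    using assms unfolding csubspace_def zero_prod_def scaleC_prod_def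
    by (blast, metis add_Pair, metis fst_conv snd_conv)
  have c0: "c *\<^sub>C (0::'a) = 0" using scaleC_add_right[of c 0 0] by simp
  have comm: "c *\<^sub>C d *\<^sub>C (x::'a) = d *\<^sub>C c *\<^sub>C x" for d x
    by (simp add: scaleC_scaleC mult.commute)
  have I: "(x, y + c *\<^sub>C x) \<in> graph_shift A c" if "(x, y) \<in> A" for x y
    using that by (auto simp: graph_shift_def)
  show ?thesis
    unfolding csubspace_def
  proof (intro conjI ballI allI)
    show "0 \<in> graph_shift A c"
      using I[OF z] by (simp add: zero_prod_def c0)
  next
    fix p q assume "p \<in> graph_shift A c" "q \<in> graph_shift A c"
    then obtain x y u v where *: "(x,y) \<in> A" "(u,v) \<in> A" "p = (x, y + c *\<^sub>C x)" "q = (u, v + c *\<^sub>C u)"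
      by (auto simp: graph_shift_def)
    show "p + q \<in> graph_shift A c"
      using I[OF a[OF *(1,2)]] by (simp add: *(3,4) scaleC_add_right add_ac)
  next
    fix d p assume "p \<in> graph_shift A c"
    then obtain x y where *: "(x,y) \<in> A" "p = (x, y + c *\<^sub>C x)"
      by (auto simp: graph_shift_def)
    show "d *\<^sub>C p \<in> graph_shift A c"
      using I[OF m[OF *(1), of d]] by (simp add: *(2) scaleC_prod_def scaleC_add_right comm)
  qed
qed

lemma self_adjoint_resolvent:
  fixes A :: "('a::complex_inner \<times> 'a) set"
  assumes A: "self_adjoint_graph A" and s: "s \<noteq> 0"
  shows "graph_invertible (graph_shift A (\<i> * complex_of_real s))"
    and "bounded_clinear (resolvent_at A s)"
proof -
  define B where "B = graph_shift A (\<i> * complex_of_real s)"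
  define R where "R = resolvent_at A s"
  have sub: "csubspace B"
    using A csubspace_shift unfolding B_def self_adjoint_graph_def by blast
  then have add: "\<And>x y u v. (x,y) \<in> B \<Longrightarrow> (u,v) \<in> B \<Longrightarrow> (x+u,y+v) \<in> B"
    and mul: "\<And>d x y. (x,y) \<in> B \<Longrightarrow> (d *\<^sub>C x, d *\<^sub>C y) \<in> B"
    unfolding csubspace_def scaleC_prod_def by (metis add_Pair, metis fst_conv snd_conv)
  have neg: "(- x, - y) \<in> B" if "(x, y) \<in> B" for x y
    using mul[OF that, of "complex_of_real (-1)"] by (simp flip: scaleR_scaleC del: of_real_minus)
  have surj: "\<exists>x. (x, y) \<in> B" for y
    using A s unfolding B_def self_adjoint_graph_def by blast
  have bnd: "norm x \<le> norm y * (1 / \<bar>s\<bar>)" if "(x, y) \<in> B" for x y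
  proof -
    obtain v where v: "(x, v) \<in> A" "y = v + (\<i> * complex_of_real s) *\<^sub>C x"
      using \<open>(x, y) \<in> B\<close> by (auto simp: B_def graph_shift_def)
    then have "(norm y)\<^sup>2 = (norm v)\<^sup>2 + s\<^sup>2 * (norm x)\<^sup>2"
      using A shift_norm[of x v s] by (auto simp: self_adjoint_graph_def)
    then have "(\<bar>s\<bar> * norm x)\<^sup>2 \<le> (norm y)\<^sup>2" by (simp add: power_mult_distrib)
    then have "\<bar>s\<bar> * norm x \<le> norm y" by (rule power2_le_imp_le) simp
    then show ?thesis using s by (simp add: field_simps)
  qed
  have uniq: "x = u" if "(x, y) \<in> B" "(u, y) \<in> B" for x u y
    using bnd[OF add[OF that(1) neg[OF that(2)]]] by simp
  have R_iff: "(x, y) \<in> B \<longleftrightarrow> x = R y" for x y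
  proof -
    have "\<exists>!x. (x, y) \<in> B" using surj uniq by blast
    then have "(R y, y) \<in> B"
      unfolding R_def resolvent_at_def graph_inverse_def B_def[symmetric] by (rule theI')
    then show ?thesis using uniq by blast
  qed
  have lin: "R (y + v) = R y + R v" "R (c *\<^sub>C y) = c *\<^sub>C R y" for y v c
    using add[of "R y" y "R v" v] mul[of "R y" y c] by (simp_all add: R_iff)
  have bndR: "norm (R y) \<le> norm y * (1 / \<bar>s\<bar>)" for y
    using bnd[of "R y" y] R_iff[of "R y" y] by blast
  have bl: "bounded_linear R"
    by (rule bounded_linear_intro[where K = "1 / \<bar>s\<bar>"]) (simp_all only: lin bndR scaleR_scaleC)
  show "bounded_clinear (resolvent_at A s)"
    using bl lin by (simp add: bounded_clinear_def R_def)
  have "B = {p. fst p = R (snd p)}" using R_iff by auto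
  moreover have "closed {p. fst p = R (snd p)}"
    by (intro closed_Collect_eq continuous_on_fst continuous_on_snd continuous_on_id
        bounded_linear.continuous_on[OF bl])
  ultimately have "closed B" by simp
  then show "graph_invertible (graph_shift A (\<i> * complex_of_real s))"
    using sub R_iff unfolding graph_invertible_def B_def[symmetric] by simp
qed

end

end

theory Submission
  imports Defs "HOL-Computational_Algebra.Polynomial" "HOL-Real_Asymp.Real_Asymp"
begin

text \<open>All graphs satisfy the same lower bound \<open>- \<omega>\<close>. Hence the resolvents
  \<open>R = (A + \<omega> + 1)\<^sup>-\<^sup>1\<close> and \<open>R\<^sub>n = (A\<^sub>n + \<omega> + 1)\<^sup>-\<^sup>1\<close> at one common real point exist, and they are symmetric
  with \<open>0 \<le> R \<le> I\<close>. A number \<open>\<lambda> \<ge> - \<omega>\<close> corresponds to \<open>u = 1 / (\<lambda> + \<omega> + 1)\<close> in \<open>(0, 1]\<close>, and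
  \<open>u = 0\<close> to the multivalued part \<open>A(0)\<close>, that is to \<open>\<lambda> = \<infinity>\<close>. In this variable \<open>exp (- t \<lambda>)\<close> is a
  function \<open>f\<close> that extends continuously to \<open>[0, 1]\<close> with \<open>f 0 = 0\<close>, and the claim becomes
  \<open>f(R\<^sub>n) \<longlonglongrightarrow> f(R)\<close>.

  Functions of \<open>R\<close> are provided by a continuous functional calculus on \<open>[0, 1]\<close> for operators with
  \<open>0 \<le> T \<le> I\<close>. Its only analytic input is \<open>norm_poly_op_le\<close>: the norm of \<open>p(T)\<close> is at most the
  maximum of \<open>\<bar>p\<bar>\<close> on \<open>[0, 1]\<close>. This follows from positivity of \<open>q(T)\<close> for \<open>q \<ge> 0\<close> on \<open>[0, 1]\<close>
  (\<open>poly_op_nonneg\<close>), which in turn comes from the Bernstein expansion of \<open>q\<close>, because the operators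
  \<open>T\<^sup>i (I - T)\<^sup>j\<close> are positive.

  In the variable \<open>u\<close> the Euler approximations \<open>(1 + t \<lambda> / n)\<^bsup>-n\<^esup>\<close> converge to \<open>f\<close> uniformly on
  \<open>[0, 1]\<close> (\<open>uniform_limit_euler_symbol\<close>), so the limit that defines the exponential is \<open>f(R)\<close>
  (\<open>graph_exp_eq_calculus\<close>). Convergence of the resolvents at \<open>i s\<close>, strong or in norm, passes to
  \<open>R\<^sub>n \<longlonglongrightarrow> R\<close> by the resolvent identity (\<open>shifted_resolvent_diff_le\<close>), from there to polynomials of
  \<open>R\<^sub>n\<close>, and by uniform approximation to \<open>f(R\<^sub>n)\<close>.\<close>

section \<open>The real inner product and positive contractions\<close>

text \<open>Positivity of symmetric operators and the functional calculus live in the underlying real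
  Hilbert space.\<close>

definition re_inner :: "'a::complex_inner \<Rightarrow> 'a \<Rightarrow> real" where
  "re_inner x y = Re (cinner x y)"

lemma re_inner_commute: "re_inner x y = re_inner y x"
  unfolding re_inner_def by (subst cinner_commute) simp

lemma re_inner_add_left: "re_inner (x + y) z = re_inner x z + re_inner y z"
  by (simp add: re_inner_def cinner_add_left)

lemma re_inner_add_right: "re_inner x (y + z) = re_inner x y + re_inner x z"
  using re_inner_add_left re_inner_commute by metis

lemma re_inner_scaleR_left: "re_inner (r *\<^sub>R x) y = r * re_inner x y"
  by (simp add: re_inner_def scaleR_scaleC cinner_scaleC_left)

lemma re_inner_scaleR_right: "re_inner x (r *\<^sub>R y) = r * re_inner x y"
  using re_inner_scaleR_left re_inner_commute by metis

lemma re_inner_diff_left: "re_inner (x - y) z = re_inner x z - re_inner y z"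
  using re_inner_add_left[of x "- y" z] re_inner_scaleR_left[of "-1" y z] by simp

lemma re_inner_diff_right: "re_inner x (y - z) = re_inner x y - re_inner x z"
  using re_inner_diff_left re_inner_commute by metis

lemma re_inner_0: "re_inner 0 x = 0" "re_inner x 0 = 0"
  using re_inner_scaleR_left[of 0 x x] re_inner_scaleR_right[of x 0 x] by simp_all

lemmas re_inner_linear = re_inner_add_left re_inner_add_right re_inner_diff_left
  re_inner_diff_right re_inner_scaleR_left re_inner_scaleR_right re_inner_0

lemma power2_norm_re_inner: "(norm x)\<^sup>2 = re_inner x x"
  by (simp add: re_inner_def norm_eq_sqrt_cinner cinner_ge_zero)

lemma norm_scaleC: "norm (c *\<^sub>C (x::'a::complex_inner)) = cmod c * norm x"
proof -
  have "cinner x (c *\<^sub>C x) = cnj c * cinner x x"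
    by (metis cinner_commute cinner_scaleC_left complex_cnj_mult)
  then have "cinner (c *\<^sub>C x) (c *\<^sub>C x) = of_real ((cmod c)\<^sup>2) * cinner x x"
    by (simp add: cinner_scaleC_left complex_norm_square del: of_real_power)
  then have "(norm (c *\<^sub>C x))\<^sup>2 = (cmod c * norm x)\<^sup>2"
    unfolding power_mult_distrib power2_norm_re_inner re_inner_def by simp
  then show ?thesis by simp
qed

lemma scaleC_diff_right: "c *\<^sub>C (x - y) = c *\<^sub>C x - c *\<^sub>C (y::'a::complex_vector)"
  using scaleC_add_right[of c "x - y" y] by (simp add: algebra_simps)

lemma scaleC_zero_right: "c *\<^sub>C (0::'a::complex_vector) = 0"
  using scaleC_diff_right[of c 0 0] by simp

lemma tendsto_scaleC:
  assumes "f \<longlonglongrightarrow> (l::'a::complex_inner)"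
  shows "(\<lambda>n. c *\<^sub>C f n) \<longlonglongrightarrow> c *\<^sub>C l"
proof -
  have "(\<lambda>n. cmod c * norm (f n - l)) \<longlonglongrightarrow> cmod c * 0"
    using assms by (intro tendsto_intros) (simp add: LIM_zero_iff tendsto_norm_zero_iff)
  then have "(\<lambda>n. norm (c *\<^sub>C f n - c *\<^sub>C l)) \<longlonglongrightarrow> 0"
    by (simp flip: norm_scaleC scaleC_diff_right)
  then show ?thesis by (simp add: tendsto_norm_zero_iff LIM_zero_iff)
qed

text \<open>The last condition says \<open>T\<^sup>2 \<le> T\<close>, which for symmetric \<open>T\<close> is the same as
  \<open>0 \<le> T \<le> I\<close>; for resolvents it is the form that comes out of the estimates.\<close>

definition positive_contraction :: "('a::complex_inner \<Rightarrow> 'a) \<Rightarrow> bool" where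
  "positive_contraction T \<longleftrightarrow> bounded_clinear T \<and>
     (\<forall>x y. re_inner (T x) y = re_inner x (T y)) \<and>
     (\<forall>x. (norm (T x))\<^sup>2 \<le> re_inner (T x) x)"

lemma positive_contraction_linear: "positive_contraction T \<Longrightarrow> linear T"
  by (simp add: positive_contraction_def bounded_clinear_def bounded_linear.linear)

lemma positive_contraction_le_id:
  assumes "positive_contraction T"
  shows "re_inner (T x) x \<le> (norm x)\<^sup>2"
proof -
  have "(norm (T x))\<^sup>2 \<le> re_inner (T x) x"
    using assms unfolding positive_contraction_def by blast
  moreover have "0 \<le> (norm (x - T x))\<^sup>2" by simp
  moreover have "re_inner x (T x) = re_inner (T x) x" by (rule re_inner_commute)
  ultimately show ?thesis
    unfolding power2_norm_re_inner re_inner_linear by linarith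
qed

lemma norm_positive_contraction_le:
  assumes "positive_contraction T"
  shows "norm (T x) \<le> norm x"
proof (rule power2_le_imp_le)
  show "(norm (T x))\<^sup>2 \<le> (norm x)\<^sup>2"
    using positive_contraction_le_id[OF assms, of x] assms
    unfolding positive_contraction_def by (meson order_trans)
qed simp

section \<open>Polynomials of an operator\<close>

text \<open>Horner evaluation, in analogy with the fold that evaluates a polynomial at a number.\<close>

definition poly_op :: "('a \<Rightarrow> 'a) \<Rightarrow> real poly \<Rightarrow> 'a \<Rightarrow> 'a::real_vector" where
  "poly_op T p = fold_coeffs (\<lambda>a f x. a *\<^sub>R x + T (f x)) p (\<lambda>x. 0)"

lemma poly_op_0 [simp]: "poly_op T 0 x = 0"
  by (simp add: poly_op_def)

lemma poly_op_pCons: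
  assumes "linear T"
  shows "poly_op T (pCons a p) x = a *\<^sub>R x + T (poly_op T p x)"
  by (cases "p = 0 \<and> a = 0") (auto simp: poly_op_def linear_0[OF assms])

lemma poly_op_1:
  assumes "linear T"
  shows "poly_op T 1 x = x"
  by (simp add: poly_op_pCons[OF assms] linear_0[OF assms] one_pCons)

lemma poly_op_add:
  assumes "linear T"
  shows "poly_op T (p + q) x = poly_op T p x + poly_op T q x"
proof (induction p q rule: poly_induct2)
  case (pCons a p b q)
  then show ?case
    by (simp add: poly_op_pCons[OF assms] linear_add[OF assms] algebra_simps)
qed simp

lemma poly_op_smult:
  assumes "linear T"
  shows "poly_op T (smult c p) x = c *\<^sub>R poly_op T p x"
  by (induction p)
     (simp_all add: poly_op_pCons[OF assms] linear_scale[OF assms] scaleR_add_right)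

lemma poly_op_diff:
  assumes "linear T"
  shows "poly_op T (p - q) x = poly_op T p x - poly_op T q x"
  using poly_op_add[OF assms, of p "- q" x] poly_op_smult[OF assms, of "-1" q x] by simp

lemma poly_op_mult:
  assumes "linear T"
  shows "poly_op T (p * q) x = poly_op T p (poly_op T q x)"
  by (induction p)
     (simp_all add: poly_op_pCons[OF assms] poly_op_add[OF assms] poly_op_smult[OF assms])

lemma bounded_clinear_poly_op:
  assumes "bounded_clinear T"
  shows "bounded_clinear (poly_op T p)"
proof (induction p)
  case 0
  then show ?case
    by (simp add: bounded_clinear_def scaleC_zero_right poly_op_def bounded_linear_zero)
next
  case (pCons a p)
  have bl: "bounded_linear T" using assms by (simp add: bounded_clinear_def)
  have eq: "poly_op T (pCons a p) = (\<lambda>x. a *\<^sub>R x + T (poly_op T p x))"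
    by (simp add: fun_eq_iff poly_op_pCons bounded_linear.linear[OF bl])
  have "bounded_linear (\<lambda>x. a *\<^sub>R x + T (poly_op T p x))"
    using pCons bl by (intro bounded_linear_intros bounded_linear_compose[OF bl])
      (simp add: bounded_clinear_def)
  then show ?case
    using assms pCons unfolding eq
    by (simp add: bounded_clinear_def scaleC_add_right scaleR_scaleC scaleC_scaleC mult.commute)
qed

lemma poly_op_symmetric:
  assumes "positive_contraction T"
  shows "re_inner (poly_op T p x) y = re_inner x (poly_op T p y)"
proof (induction p arbitrary: x y)
  case 0
  then show ?case by (simp add: re_inner_linear)
next
  case (pCons a p)
  have l: "linear T" by (rule positive_contraction_linear[OF assms])
  have s: "re_inner (T x) y = re_inner x (T y)" for x y
    using assms by (simp add: positive_contraction_def)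
  have c: "poly_op T p (T z) = T (poly_op T p z)" for z
    using poly_op_mult[OF l, of p "[:0,1:]" z] poly_op_mult[OF l, of "[:0,1:]" p z]
    by (simp only: mult.commute) (simp add: poly_op_pCons[OF l] linear_0[OF l])
  show ?case by (simp add: poly_op_pCons[OF l] re_inner_linear s pCons c)
qed

section \<open>Positivity of polynomials that are nonnegative on the unit interval\<close>

text \<open>An even power can be split evenly over the two sides of the inner product, which reduces
  everything to the four operators \<open>I\<close>, \<open>T\<close>, \<open>I - T\<close> and \<open>T (I - T)\<close>, whose positivity
  is visible from the definition.\<close>

lemma poly_op_bernstein_basis_nonneg:
  assumes "positive_contraction T"
  shows "0 \<le> re_inner (poly_op T ([:0, 1:] ^ i * [:1, -1:] ^ j) x) x"
proof -
  have l: "linear T" by (rule positive_contraction_linear[OF assms])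
  define q :: "real poly" where "q = [:0, 1:] ^ (i div 2) * [:1, -1:] ^ (j div 2)"
  define b :: "real poly" where "b = [:0, 1:] ^ (i mod 2) * [:1, -1:] ^ (j mod 2)"
  have sq: "a ^ n = a ^ (n div 2) * a ^ (n mod 2) * a ^ (n div 2)" for a :: "real poly" and n
  proof -
    have "n = n div 2 + n mod 2 + n div 2" by presburger
    then show ?thesis by (metis power_add)
  qed
  have "[:0, 1:] ^ i * [:1, -1:] ^ j = q * (b * q)"
    unfolding q_def b_def sq[of _ i] sq[of _ j] by (simp only: mult_ac)
  moreover have "0 \<le> re_inner (poly_op T b y) y" for y
  proof -
    have T: "(norm (T y))\<^sup>2 \<le> re_inner (T y) y" "re_inner (T y) y \<le> (norm y)\<^sup>2"
      using assms positive_contraction_le_id[OF assms, of y] by (auto simp: positive_contraction_def)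
    have TT: "re_inner (T (T y)) y = (norm (T y))\<^sup>2"
      using assms by (simp add: positive_contraction_def power2_norm_re_inner)
    have op: "poly_op T [:0, 1:] z = T z" "poly_op T [:1, -1:] z = z - T z" "poly_op T 1 z = z" for z
      by (simp_all add: poly_op_pCons[OF l] linear_0[OF l] linear_neg[OF l] poly_op_1[OF l])
    have pos: "0 \<le> re_inner (T y) y" "0 \<le> re_inner y y"
      using order_trans[OF zero_le_power2 T(1)] by (auto simp flip: power2_norm_re_inner)
    consider "i mod 2 = 0" "j mod 2 = 0" | "i mod 2 = 0" "j mod 2 = 1" | "i mod 2 = 1" "j mod 2 = 0"
      | "i mod 2 = 1" "j mod 2 = 1" by linarith
    then show ?thesis
      by cases (use T pos TT in \<open>simp_all add: b_def poly_op_mult[OF l] op re_inner_linear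
          linear_diff[OF l] power2_norm_re_inner del: mult_pCons_left mult_pCons_right\<close>)
  qed
  ultimately show ?thesis
    by (simp add: poly_op_mult[OF l] poly_op_symmetric[OF assms, of q])
qed

text \<open>Writing \<open>u\<^sup>m = u\<^sup>m (u + (1 - u))\<^bsup>N-m\<^esup>\<close> expands a monomial exactly in the Bernstein basis of
  degree \<open>N\<close>. Its coefficients are close to the values \<open>(i / N)\<^sup>m\<close> of the monomial itself.\<close>

lemma monomial_bernstein_expansion:
  assumes "m \<le> N"
  shows "([:0, 1:] ^ m :: real poly) = (\<Sum>i\<le>N. smult (real (i choose m) / real (N choose m) * real (N choose i))
     ([:0, 1:] ^ i * [:1, -1:] ^ (N - i)))" (is "_ = (\<Sum>i\<le>N. ?f i)")
proof -
  let ?X = "[:0, 1:] :: real poly" and ?Y = "[:1, -1:] :: real poly"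
  have of_nat_mult_poly: "of_nat n * p = smult (real n) p" for n and p :: "real poly"
    by (simp add: of_nat_poly)
  have "?X + ?Y = 1" by (simp add: one_pCons)
  then have "?X ^ m = ?X ^ m * (?X + ?Y) ^ (N - m)" by (simp only: power_one mult_1_right)
  also have "\<dots> = (\<Sum>k\<le>N - m. ?X ^ m * (of_nat (N - m choose k) * ?X ^ k * ?Y ^ (N - m - k)))"
    by (simp only: binomial_ring sum_distrib_left)
  also have "\<dots> = (\<Sum>k\<le>N - m. ?f (k + m))"
  proof (rule sum.cong)
    fix k assume "k \<in> {..N - m}"
    then have k: "k + m \<le> N" using assms by auto
    have "real ((k + m) choose m) * real (N choose (k + m)) = real (N choose m) * real (N - m choose k)"
      using choose_mult[of m "k + m" N] k by (simp add: mult.commute flip: of_nat_mult)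
    then have "real ((k + m) choose m) / real (N choose m) * real (N choose (k + m)) = real (N - m choose k)"
      using assms by (simp add: field_simps)
    moreover have "N - m - k = N - (k + m)" using k by simp
    ultimately show "?X ^ m * (of_nat (N - m choose k) * ?X ^ k * ?Y ^ (N - m - k)) = ?f (k + m)"
      by (simp add: power_add mult_ac of_nat_mult_poly del: mult_pCons_left mult_pCons_right)
  qed simp
  also have "\<dots> = (\<Sum>i=0+m..N-m+m. ?f i)"
    by (simp only: sum.shift_bounds_cl_nat_ivl atMost_atLeast0)
  also have "\<dots> = (\<Sum>i\<le>N. ?f i)"
    using assms by (intro sum.mono_neutral_left) (auto simp: not_le)
  finally show ?thesis .
qed

text \<open>Both numbers are products of \<open>m\<close> factors in which \<open>(i - j) / (N - j)\<close> faces \<open>i / N\<close>. The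
  factors differ by at most \<open>j / (N - j)\<close>, and these errors add up because the partial products stay
  in \<open>[0, 1]\<close>.\<close>

lemma binomial_quotient_approx:
  assumes "m \<le> N" "i \<le> N"
  shows "\<bar>real (i choose m) / real (N choose m) - (real i / real N) ^ m\<bar> \<le> (real m)\<^sup>2 / (real N + 1 - real m)"
  using assms(1)
proof (induction m)
  case 0
  then show ?case by simp
next
  case (Suc m)
  define a where "a = real (i choose m) / real (N choose m)"
  have m: "m < N" using Suc by simp
  have rec: "real (Suc m) * real (n choose Suc m) = (real n - real m) * real (n choose m)" for n
  proof (cases "m \<le> n")
    case True
    then show ?thesis
      using binomial_absorption[of m n] binomial_absorb_comp[of n m]
      by (metis of_nat_diff of_nat_mult)
  qed (simp add: binomial_eq_0)
  have "real (i choose Suc m) / real (N choose Suc m)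
      = (real (Suc m) * real (i choose Suc m)) / (real (Suc m) * real (N choose Suc m))" by simp
  also have "\<dots> = a * ((real i - real m) / (real N - real m))"
    unfolding rec a_def by (simp add: mult.commute)
  finally have step: "real (i choose Suc m) / real (N choose Suc m)
      = a * ((real i - real m) / (real N - real m))" .
  have a01: "0 \<le> a" "a \<le> 1"
    using assms(2) m by (auto simp: a_def divide_le_eq_1 intro!: binomial_right_mono)
  have x01: "0 \<le> real i / real N" "real i / real N \<le> 1"
    using assms(2) by (auto simp: divide_le_eq_1)
  have "(real i - real m) / (real N - real m) - real i / real N
      = - (real m / (real N - real m)) * (1 - real i / real N)"
    using m by (simp add: field_simps)
  then have "\<bar>(real i - real m) / (real N - real m) - real i / real N\<bar>
      = real m / (real N - real m) * (1 - real i / real N)"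
    using m x01 by (simp add: abs_mult)
  also have "\<dots> \<le> real m / (real N - real m)"
    using m x01 by (intro mult_left_le) auto
  finally have d: "\<bar>(real i - real m) / (real N - real m) - real i / real N\<bar> \<le> real m / (real N - real m)" .
  have "real (i choose Suc m) / real (N choose Suc m) - (real i / real N) ^ Suc m
      = a * ((real i - real m) / (real N - real m) - real i / real N)
        + (real i / real N) * (a - (real i / real N) ^ m)"
    unfolding step by (simp add: algebra_simps)
  also have "\<bar>\<dots>\<bar> \<le> a * \<bar>(real i - real m) / (real N - real m) - real i / real N\<bar>
        + (real i / real N) * \<bar>a - (real i / real N) ^ m\<bar>"
    using a01 x01 by (intro order_trans[OF abs_triangle_ineq]) (simp add: abs_mult)
  also have "\<dots> \<le> \<bar>(real i - real m) / (real N - real m) - real i / real N\<bar> + \<bar>a - (real i / real N) ^ m\<bar>"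
    using a01 x01 by (intro add_mono mult_left_le_one_le) auto
  also have "\<dots> \<le> real m / (real N - real m) + (real m)\<^sup>2 / (real N + 1 - real m)"
    using d Suc m unfolding a_def by (intro add_mono) auto
  also have "\<dots> \<le> real m / (real N - real m) + (real m)\<^sup>2 / (real N - real m)"
    using m by (intro add_left_mono divide_left_mono) auto
  also have "\<dots> \<le> (real (Suc m))\<^sup>2 / (real N + 1 - real (Suc m))"
    using m by (simp add: power2_eq_square algebra_simps divide_right_mono flip: add_divide_distrib)
  finally show ?case .
qed

text \<open>For large degree the Bernstein coefficients of \<open>q\<close> are nearly values of \<open>q\<close>, hence nearly
  nonnegative, while the basis operators are positive and sum to the identity.\<close>

lemma poly_op_nonneg:
  assumes T: "positive_contraction T" and q: "\<And>u. 0 \<le> u \<Longrightarrow> u \<le> 1 \<Longrightarrow> 0 \<le> poly q u"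
  shows "0 \<le> re_inner (poly_op T q x) x"
proof -
  have l: "linear T" by (rule positive_contraction_linear[OF T])
  define d where "d = degree q"
  define C where "C = (\<Sum>m\<le>d. \<bar>coeff q m\<bar>)"
  define B :: "nat \<Rightarrow> nat \<Rightarrow> real poly"
    where "B N i = [:0, 1:] ^ i * [:1, -1:] ^ (N - i)" for N i
  define L where "L p = re_inner (poly_op T p x) x" for p :: "real poly"
  have L_sum: "L (\<Sum>i\<in>I. smult (c i) (p i)) = (\<Sum>i\<in>I. c i * L (p i))" for c p and I :: "nat set"
    by (induction I rule: infinite_finite_induct)
       (simp_all add: L_def poly_op_add[OF l] poly_op_smult[OF l] re_inner_linear)
  have L_B: "0 \<le> L (B N i)" for N i
    unfolding L_def B_def by (rule poly_op_bernstein_basis_nonneg[OF T])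
  have L_mono: "L ([:0, 1:] ^ m) = (\<Sum>i\<le>N. real (i choose m) / real (N choose m) * real (N choose i) * L (B N i))"
    if "m \<le> N" for m N
    by (subst monomial_bernstein_expansion[OF that]) (simp only: L_sum flip: B_def)
  have bound: "- (C * ((real d)\<^sup>2 / (real N + 1 - real d)) * (norm x)\<^sup>2) \<le> L q" if N: "d \<le> N" for N
  proof -
    define r where "r = (real d)\<^sup>2 / (real N + 1 - real d)"
    define c where "c i = (\<Sum>m\<le>d. coeff q m * (real (i choose m) / real (N choose m)))" for i
    have c: "- (C * r) \<le> c i" if i: "i \<le> N" for i
    proof -
      have "\<bar>c i - poly q (real i / real N)\<bar>
          = \<bar>\<Sum>m\<le>d. coeff q m * (real (i choose m) / real (N choose m) - (real i / real N) ^ m)\<bar>"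
        by (simp add: c_def poly_altdef d_def sum_subtractf right_diff_distrib)
      also have "\<dots> \<le> (\<Sum>m\<le>d. \<bar>coeff q m\<bar> * \<bar>real (i choose m) / real (N choose m) - (real i / real N) ^ m\<bar>)"
        by (intro order_trans[OF sum_abs]) (simp add: abs_mult)
      also have "\<dots> \<le> (\<Sum>m\<le>d. \<bar>coeff q m\<bar> * r)"
      proof (intro sum_mono mult_left_mono)
        fix m assume "m \<in> {..d}"
        then have "(real m)\<^sup>2 / (real N + 1 - real m) \<le> r"
          unfolding r_def using N by (intro frac_le) auto
        then show "\<bar>real (i choose m) / real (N choose m) - (real i / real N) ^ m\<bar> \<le> r"
          using binomial_quotient_approx[of m N i] \<open>m \<in> {..d}\<close> N i by auto
      qed simp
      also have "\<dots> = C * r" by (simp add: C_def sum_distrib_right)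
      finally have "\<bar>c i - poly q (real i / real N)\<bar> \<le> C * r" .
      moreover have "0 \<le> poly q (real i / real N)"
        using i by (intro q) (auto simp: divide_le_eq_1)
      ultimately show ?thesis by linarith
    qed
    have "q = (\<Sum>m\<le>d. smult (coeff q m) ([:0, 1:] ^ m))"
      using poly_as_sum_of_monoms[of q] by (simp add: d_def monom_altdef)
    then have "L q = (\<Sum>m\<le>d. coeff q m * L ([:0, 1:] ^ m))"
      using L_sum by metis
    also have "\<dots> = (\<Sum>m\<le>d. \<Sum>i\<le>N. coeff q m * (real (i choose m) / real (N choose m)) * (real (N choose i) * L (B N i)))"
      using N by (intro sum.cong) (simp_all add: L_mono[where N = N] sum_distrib_left mult_ac)
    also have "\<dots> = (\<Sum>i\<le>N. c i * (real (N choose i) * L (B N i)))"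
      by (subst sum.swap) (simp add: c_def sum_distrib_right)
    also have "\<dots> \<ge> (\<Sum>i\<le>N. - (C * r) * (real (N choose i) * L (B N i)))"
      using c L_B by (intro sum_mono mult_right_mono) auto
    also have "(\<Sum>i\<le>N. - (C * r) * (real (N choose i) * L (B N i))) = - (C * r) * L 1"
      using L_mono[of 0 N] by (simp add: sum_distrib_left)
    also have "L 1 = (norm x)\<^sup>2"
      by (simp add: L_def poly_op_1[OF l] power2_norm_re_inner)
    finally show ?thesis by (simp add: r_def)
  qed
  have "(\<lambda>N. - (C * ((real d)\<^sup>2 / (real N + 1 - real d)) * (norm x)\<^sup>2)) \<longlonglongrightarrow> 0"
    by real_asymp
  then have "0 \<le> L q"
    by (rule LIMSEQ_le_const2) (use bound in auto)
  then show ?thesis by (simp add: L_def)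
qed

text \<open>The square of \<open>norm (p(T) x)\<close> is the form of \<open>p\<^sup>2(T)\<close> at \<open>x\<close>, so the bound is positivity of
  \<open>M\<^sup>2 - p\<^sup>2\<close>.\<close>

lemma norm_poly_op_le:
  assumes T: "positive_contraction T" and M: "\<And>u. 0 \<le> u \<Longrightarrow> u \<le> 1 \<Longrightarrow> \<bar>poly p u\<bar> \<le> M"
  shows "norm (poly_op T p x) \<le> M * norm x"
proof (rule power2_le_imp_le)
  have l: "linear T" by (rule positive_contraction_linear[OF T])
  have M0: "0 \<le> M" using M[of 0] by simp
  have "0 \<le> re_inner (poly_op T ([:M\<^sup>2:] - p * p) x) x"
  proof (rule poly_op_nonneg[OF T])
    fix u :: real assume "0 \<le> u" "u \<le> 1"
    then have "\<bar>poly p u\<bar>\<^sup>2 \<le> M\<^sup>2" by (intro power_mono M) auto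
    then show "0 \<le> poly ([:M\<^sup>2:] - p * p) u" by (simp add: power2_eq_square)
  qed
  then show "(norm (poly_op T p x))\<^sup>2 \<le> (M * norm x)\<^sup>2"
    by (simp add: poly_op_diff[OF l] poly_op_smult[OF l] poly_op_mult[OF l] re_inner_linear
        poly_op_symmetric[OF T, of p "poly_op T p x"] power_mult_distrib power2_norm_re_inner poly_op_pCons[OF l] linear_0[OF l]
        poly_op_1[OF l])
  show "0 \<le> M * norm x" using M0 by simp
qed

section \<open>Continuous functional calculus\<close>

definition bernstein_poly :: "(real \<Rightarrow> real) \<Rightarrow> nat \<Rightarrow> real poly" where
  "bernstein_poly f N =
     (\<Sum>k\<le>N. smult (f (k / N) * real (N choose k)) ([:0, 1:] ^ k * [:1, -1:] ^ (N - k)))"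

lemma poly_bernstein_poly:
  "poly (bernstein_poly f N) u = (\<Sum>k\<le>N. f (k / N) * Bernstein N k u)"
  by (simp add: bernstein_poly_def poly_sum Bernstein_def mult_ac)

lemma uniform_limit_bernstein_poly:
  assumes "continuous_on {0..1} f"
  shows "uniform_limit {0..1} (\<lambda>N. poly (bernstein_poly f N)) f sequentially"
  unfolding uniform_limit_sequentially_iff dist_real_def poly_bernstein_poly
proof (intro allI impI)
  fix e :: real assume "0 < e"
  from Bernstein_Weierstrass[OF assms this]
  obtain N where N: "\<forall>n u. N \<le> n \<and> u \<in> {0..1} \<longrightarrow> \<bar>f u - (\<Sum>k\<le>n. f (k / n) * Bernstein n k u)\<bar> < e"
    by (rule exE)
  then show "\<exists>N. \<forall>n\<ge>N. \<forall>u\<in>{0..1}. \<bar>(\<Sum>k\<le>n. f (k / n) * Bernstein n k u) - f u\<bar> < e"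
    by (subst abs_minus_commute) blast
qed

text \<open>The operator \<open>f(T)\<close>. The Bernstein polynomials serve as one concrete sequence of polynomials that
  tends to \<open>f\<close> uniformly; by the bound on \<open>p(T)\<close> every other such sequence gives the same limit.\<close>

definition calculus :: "('a::chilbert_space \<Rightarrow> 'a) \<Rightarrow> (real \<Rightarrow> real) \<Rightarrow> 'a \<Rightarrow> 'a" where
  "calculus T f x = lim (\<lambda>N. poly_op T (bernstein_poly f N) x)"

lemma calculus_tendsto:
  assumes T: "positive_contraction T" and f: "continuous_on {0..1} f"
  shows "(\<lambda>N. poly_op T (bernstein_poly f N) x) \<longlonglongrightarrow> calculus T f x"
proof -
  have l: "linear T" by (rule positive_contraction_linear[OF T])
  have "Cauchy (\<lambda>N. poly_op T (bernstein_poly f N) x)"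
  proof (rule metric_CauchyI)
    fix e :: real assume "0 < e"
    define d where "d = e / (4 * (norm x + 1))"
    have nz: "norm x + 1 \<noteq> 0" using norm_ge_zero[of x] by linarith
    have d: "0 < d" using \<open>0 < e\<close> by (simp add: d_def add_nonneg_pos)
    obtain N where N: "\<And>n u. N \<le> n \<Longrightarrow> u \<in> {0..1} \<Longrightarrow> \<bar>poly (bernstein_poly f n) u - f u\<bar> < d"
      using uniform_limitD[OF uniform_limit_bernstein_poly[OF f] d]
      unfolding eventually_sequentially dist_real_def by blast
    have "dist (poly_op T (bernstein_poly f m) x) (poly_op T (bernstein_poly f n) x) < e"
      if "N \<le> m" "N \<le> n" for m n
    proof -
      have "\<bar>poly (bernstein_poly f m - bernstein_poly f n) u\<bar> \<le> 2 * d" if "0 \<le> u" "u \<le> 1" for u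
        using N[OF \<open>N \<le> m\<close>, of u] N[OF \<open>N \<le> n\<close>, of u] that unfolding poly_diff atLeastAtMost_iff by linarith
      then have "norm (poly_op T (bernstein_poly f m - bernstein_poly f n) x) \<le> 2 * d * norm x"
        by (rule norm_poly_op_le[OF T])
      also have "\<dots> \<le> 2 * d * (norm x + 1)" using d by simp
      also have "\<dots> = e / 2" using nz by (simp add: d_def field_simps)
      also have "\<dots> < e" using \<open>0 < e\<close> by simp
      finally show ?thesis by (simp add: dist_norm poly_op_diff[OF l])
    qed
    then show "\<exists>M. \<forall>m\<ge>M. \<forall>n\<ge>M. dist (poly_op T (bernstein_poly f m) x) (poly_op T (bernstein_poly f n) x) < e"
      by blast
  qed
  then show ?thesis
    unfolding calculus_def by (simp only: Cauchy_convergent_iff convergent_LIMSEQ_iff)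
qed

text \<open>Since \<open>f\<close> is a uniform limit of polynomials, this estimate determines \<open>f(T)\<close>.\<close>

lemma calculus_approx:
  assumes T: "positive_contraction T" and f: "continuous_on {0..1} f"
    and p: "\<And>u. 0 \<le> u \<Longrightarrow> u \<le> 1 \<Longrightarrow> \<bar>poly p u - f u\<bar> \<le> e"
  shows "norm (poly_op T p x - calculus T f x) \<le> e * norm x"
proof (rule field_le_epsilon)
  have l: "linear T" by (rule positive_contraction_linear[OF T])
  fix d' :: real assume "0 < d'"
  define d where "d = d' / (norm x + 1)"
  have d: "0 < d" "d * norm x \<le> d'"
    using \<open>0 < d'\<close> by (auto simp: d_def add_nonneg_pos divide_simps mult_left_mono)
  obtain N where N: "\<And>n u. N \<le> n \<Longrightarrow> u \<in> {0..1} \<Longrightarrow> \<bar>poly (bernstein_poly f n) u - f u\<bar> < d"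
    using uniform_limitD[OF uniform_limit_bernstein_poly[OF f] d(1)]
    unfolding eventually_sequentially dist_real_def by blast
  have bound: "norm (poly_op T p x - poly_op T (bernstein_poly f n) x) \<le> (e + d) * norm x" if "N \<le> n" for n
  proof -
    have "\<bar>poly (p - bernstein_poly f n) u\<bar> \<le> e + d" if "0 \<le> u" "u \<le> 1" for u
      using N[OF \<open>N \<le> n\<close>, of u] p[of u] that unfolding poly_diff atLeastAtMost_iff by linarith
    then show ?thesis
      using norm_poly_op_le[OF T] by (simp flip: poly_op_diff[OF l])
  qed
  have "(\<lambda>n. norm (poly_op T p x - poly_op T (bernstein_poly f n) x))
      \<longlonglongrightarrow> norm (poly_op T p x - calculus T f x)"
    by (intro tendsto_intros calculus_tendsto[OF T f])
  then have "norm (poly_op T p x - calculus T f x) \<le> (e + d) * norm x"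
    by (rule LIMSEQ_le_const2) (use bound in blast)
  then show "norm (poly_op T p x - calculus T f x) \<le> e * norm x + d'"
    using d(2) by (simp add: distrib_right)
qed

lemma polynomial_approx:
  fixes f :: "real \<Rightarrow> real"
  assumes "continuous_on {0..1} f" "0 < e"
  obtains p where "\<And>u. 0 \<le> u \<Longrightarrow> u \<le> 1 \<Longrightarrow> \<bar>poly p u - f u\<bar> \<le> e"
proof -
  from uniform_limitD[OF uniform_limit_bernstein_poly[OF assms(1)] assms(2)]
  obtain N where "\<And>n. N \<le> n \<Longrightarrow> \<forall>u\<in>{0..1}. dist (poly (bernstein_poly f n) u) (f u) < e"
    unfolding eventually_sequentially by blast
  from this[OF order_refl] show ?thesis
    by (intro that[of "bernstein_poly f N"]) (auto simp: dist_real_def intro!: less_imp_le)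
qed

lemma calculus_poly:
  assumes "positive_contraction T"
  shows "calculus T (poly p) x = poly_op T p x"
  using calculus_approx[OF assms, of "poly p" p 0 x] by (simp add: continuous_on_poly)

lemma calculus_cong:
  assumes "\<And>u. 0 \<le> u \<Longrightarrow> u \<le> 1 \<Longrightarrow> f u = g u"
  shows "calculus T f x = calculus T g x"
proof -
  have "bernstein_poly f N = bernstein_poly g N" for N
    unfolding bernstein_poly_def
    by (intro sum.cong refl arg_cong2[where f = smult] arg_cong2[where f = "(*)"] assms)
       (auto simp: divide_le_eq_1)
  then show ?thesis by (simp add: calculus_def)
qed

lemma calculus_norm_diff_le:
  assumes T: "positive_contraction T" and f: "continuous_on {0..1} f" and g: "continuous_on {0..1} g"
    and fg: "\<And>u. 0 \<le> u \<Longrightarrow> u \<le> 1 \<Longrightarrow> \<bar>f u - g u\<bar> \<le> e"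
  shows "norm (calculus T f x - calculus T g x) \<le> e * norm x"
proof (rule field_le_epsilon)
  fix d' :: real assume "0 < d'"
  define d where "d = d' / (2 * (norm x + 1))"
  have d: "0 < d" "2 * d * norm x \<le> d'"
    using \<open>0 < d'\<close> by (auto simp: d_def add_nonneg_pos divide_simps mult_left_mono)
  obtain p where p: "\<And>u. 0 \<le> u \<Longrightarrow> u \<le> 1 \<Longrightarrow> \<bar>poly p u - f u\<bar> \<le> d"
    using polynomial_approx[OF f d(1)] by blast
  have "\<bar>poly p u - g u\<bar> \<le> e + d" if "0 \<le> u" "u \<le> 1" for u
    using p[OF that] fg[OF that] by linarith
  then have "norm (poly_op T p x - calculus T g x) \<le> (e + d) * norm x"
    by (rule calculus_approx[OF T g])
  moreover have "norm (poly_op T p x - calculus T f x) \<le> d * norm x"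
    using p by (rule calculus_approx[OF T f])
  moreover have "norm (calculus T f x - calculus T g x)
      \<le> norm (poly_op T p x - calculus T g x) + norm (poly_op T p x - calculus T f x)"
    using norm_triangle_ineq4[of "poly_op T p x - calculus T g x" "poly_op T p x - calculus T f x"] by simp
  ultimately show "norm (calculus T f x - calculus T g x) \<le> e * norm x + d'"
    using d(2) by (simp add: algebra_simps)
qed

lemma calculus_uniform_limit:
  assumes T: "positive_contraction T" and f: "\<forall>\<^sub>F n in sequentially. continuous_on {0..1} (f n)"
    and lim: "uniform_limit {0..1} f g sequentially"
  shows "(\<lambda>n. calculus T (f n) x) \<longlonglongrightarrow> calculus T g x"
proof (rule tendstoI)
  have g: "continuous_on {0..1} g"
    by (rule uniform_limit_theorem[OF f lim]) simp
  fix e :: real assume "0 < e"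
  define d where "d = e / (2 * (norm x + 1))"
  have d: "0 < d" "d * norm x < e"
    using \<open>0 < e\<close> by (auto simp: d_def add_nonneg_pos divide_simps intro: mult_strict_left_mono)
  show "\<forall>\<^sub>F n in sequentially. dist (calculus T (f n) x) (calculus T g x) < e"
    using f uniform_limitD[OF lim d(1)]
  proof eventually_elim
    case (elim n)
    then have "norm (calculus T (f n) x - calculus T g x) \<le> d * norm x"
      by (intro calculus_norm_diff_le[OF T _ g]) (auto simp: dist_real_def intro: less_imp_le)
    then show ?case using d(2) by (simp add: dist_norm)
  qed
qed

lemma bounded_clinear_calculus:
  assumes T: "positive_contraction T" and f: "continuous_on {0..1} f"
  shows "bounded_clinear (calculus T f)"
proof -
  note lim = calculus_tendsto[OF T f]
  have bc: "bounded_clinear (poly_op T p)" for p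
    using T by (simp add: bounded_clinear_poly_op positive_contraction_def)
  have lin: "linear (poly_op T p)" for p
    using bc by (simp add: bounded_clinear_def bounded_linear.linear)
  have add: "calculus T f (x + y) = calculus T f x + calculus T f y" for x y
  proof (rule LIMSEQ_unique[OF lim])
    show "(\<lambda>N. poly_op T (bernstein_poly f N) (x + y)) \<longlonglongrightarrow> calculus T f x + calculus T f y"
      using tendsto_add[OF lim[of x] lim[of y]] by (simp only: linear_add[OF lin])
  qed
  have scale: "calculus T f (c *\<^sub>C x) = c *\<^sub>C calculus T f x" for c x
  proof (rule LIMSEQ_unique[OF lim])
    show "(\<lambda>N. poly_op T (bernstein_poly f N) (c *\<^sub>C x)) \<longlonglongrightarrow> c *\<^sub>C calculus T f x"
      using tendsto_scaleC[OF lim, of c x] bc by (simp add: bounded_clinear_def)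
  qed
  obtain M where M: "\<And>u. u \<in> {0..1} \<Longrightarrow> \<bar>f u\<bar> \<le> M"
    using compact_imp_bounded[OF compact_continuous_image[OF f]] 
    unfolding bounded_iff real_norm_def by blast
  have "norm (calculus T f x) \<le> norm x * M" for x
    using calculus_approx[OF T f, of 0 M x] M by (simp add: mult.commute)
  then have "bounded_linear (calculus T f)"
    by (intro bounded_linear_intro[where K = M]) (simp_all only: add scale scaleR_scaleC)
  then show ?thesis by (simp add: bounded_clinear_def scale)
qed

text \<open>Multiplicativity holds for polynomials and is extended by uniform limits to one factor at a
  time, so that no product of two varying operators occurs.\<close>

lemma calculus_mult:
  assumes T: "positive_contraction T" and f: "continuous_on {0..1} f" and g: "continuous_on {0..1} g"
  shows "calculus T (\<lambda>u. f u * g u) x = calculus T f (calculus T g x)"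
proof -
  have l: "linear T" by (rule positive_contraction_linear[OF T])
  have pg: "calculus T (\<lambda>u. poly p u * g u) x = poly_op T p (calculus T g x)" for p
  proof (rule LIMSEQ_unique)
    have lim: "uniform_limit {0..1} (\<lambda>N u. poly p u * poly (bernstein_poly g N) u) (\<lambda>u. poly p u * g u) sequentially"
      by (intro uniform_lim_mult uniform_limit_bernstein_poly g uniform_limit_const
          compact_imp_bounded compact_continuous_image continuous_intros) auto
    have "(\<lambda>N. calculus T (\<lambda>u. poly p u * poly (bernstein_poly g N) u) x)
        \<longlonglongrightarrow> calculus T (\<lambda>u. poly p u * g u) x"
      by (rule calculus_uniform_limit[OF T _ lim]) (intro always_eventually allI continuous_intros)
    moreover have "calculus T (\<lambda>u. poly p u * poly q u) x = poly_op T p (poly_op T q x)" for q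
      using calculus_poly[OF T, of "p * q" x] by (simp add: poly_op_mult[OF l] poly_mult[abs_def])
    ultimately show "(\<lambda>N. poly_op T p (poly_op T (bernstein_poly g N) x)) \<longlonglongrightarrow> calculus T (\<lambda>u. poly p u * g u) x"
      by simp
    have "bounded_linear (poly_op T p)"
      using bounded_clinear_poly_op[of T p] T by (simp add: bounded_clinear_def positive_contraction_def)
    then show "(\<lambda>N. poly_op T p (poly_op T (bernstein_poly g N) x)) \<longlonglongrightarrow> poly_op T p (calculus T g x)"
      by (rule bounded_linear.tendsto[OF _ calculus_tendsto[OF T g]])
  qed
  have lim: "uniform_limit {0..1} (\<lambda>N u. poly (bernstein_poly f N) u * g u) (\<lambda>u. f u * g u) sequentially"
    by (intro uniform_lim_mult uniform_limit_bernstein_poly f uniform_limit_const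
        compact_imp_bounded compact_continuous_image g) auto
  show ?thesis
  proof (rule LIMSEQ_unique)
    show "(\<lambda>N. calculus T (\<lambda>u. poly (bernstein_poly f N) u * g u) x) \<longlonglongrightarrow> calculus T (\<lambda>u. f u * g u) x"
      by (rule calculus_uniform_limit[OF T _ lim]) (intro always_eventually allI continuous_intros g)
    show "(\<lambda>N. calculus T (\<lambda>u. poly (bernstein_poly f N) u * g u) x) \<longlonglongrightarrow> calculus T f (calculus T g x)"
      unfolding pg by (rule calculus_tendsto[OF T f])
  qed
qed

lemma calculus_power:
  assumes T: "positive_contraction T" and f: "continuous_on {0..1} f"
  shows "calculus T (\<lambda>u. f u ^ n) x = (calculus T f ^^ n) x"
proof (induction n arbitrary: x)
  case 0
  show ?case
    using calculus_poly[OF T, of 1 x] poly_op_1[OF positive_contraction_linear[OF T], of x]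
    by (simp add: poly_1[abs_def])
next
  case (Suc n)
  show ?case
    unfolding power_Suc funpow.simps o_apply calculus_mult[OF T f continuous_on_power[OF f]] Suc ..
qed

section \<open>Continuity of the calculus in the operator\<close>

lemma poly_op_tendsto:
  assumes T: "\<And>n. positive_contraction (T n)" and lim: "\<And>x. (\<lambda>n. T n x) \<longlonglongrightarrow> S x"
    and S: "linear S"
  shows "(\<lambda>n. poly_op (T n) p x) \<longlonglongrightarrow> poly_op S p x"
proof (induction p)
  case (pCons a p)
  define y where "y = poly_op S p x"
  have l: "linear (T n)" for n by (rule positive_contraction_linear[OF T])
  \<comment> \<open>The operator varies together with its argument; the common bound \<open>1\<close> on the norms controls this.\<close>
  have "(\<lambda>n. T n (poly_op (T n) p x - y)) \<longlonglongrightarrow> 0"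
  proof (rule Lim_null_comparison)
    show "\<forall>\<^sub>F n in sequentially. norm (T n (poly_op (T n) p x - y)) \<le> norm (poly_op (T n) p x - y)"
      using norm_positive_contraction_le[OF T] by simp
    show "(\<lambda>n. norm (poly_op (T n) p x - y)) \<longlonglongrightarrow> 0"
      using pCons(2) by (simp add: y_def tendsto_norm_zero_iff LIM_zero_iff)
  qed
  then have "(\<lambda>n. a *\<^sub>R x + (T n (poly_op (T n) p x - y) + T n y)) \<longlonglongrightarrow> a *\<^sub>R x + (0 + S y)"
    by (intro tendsto_intros lim)
  then show ?case
    by (simp add: poly_op_pCons[OF l] poly_op_pCons[OF S] linear_diff[OF l] y_def)
qed simp

text \<open>A polynomial close to \<open>f\<close> on \<open>[0, 1]\<close> gives operators close to \<open>f(T\<^sub>n)\<close> uniformly in \<open>n\<close>,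
  because all \<open>T\<^sub>n\<close> obey the same bounds.\<close>

lemma calculus_tendsto_strongly:
  assumes T: "\<And>n. positive_contraction (T n)" and S: "positive_contraction S"
    and lim: "\<And>x. (\<lambda>n. T n x) \<longlonglongrightarrow> S x" and f: "continuous_on {0..1} f"
  shows "(\<lambda>n. calculus (T n) f x) \<longlonglongrightarrow> calculus S f x"
proof (rule metric_LIMSEQ_I)
  fix e :: real assume "0 < e"
  define d where "d = e / (4 * (norm x + 1))"
  have d: "0 < d" "d * norm x < e / 3"
    using \<open>0 < e\<close> by (auto simp: d_def add_nonneg_pos divide_simps intro!: mult_strict_mono)
  obtain p where p: "\<And>u. 0 \<le> u \<Longrightarrow> u \<le> 1 \<Longrightarrow> \<bar>poly p u - f u\<bar> \<le> d"
    using polynomial_approx[OF f d(1)] by blast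
  obtain N where N: "\<And>n. N \<le> n \<Longrightarrow> dist (poly_op (T n) p x) (poly_op S p x) < e / 3"
    using metric_LIMSEQ_D[OF poly_op_tendsto[OF T lim positive_contraction_linear[OF S]], of "e / 3" p x]
      \<open>0 < e\<close> by auto
  have "dist (calculus (T n) f x) (calculus S f x) < e" if "N \<le> n" for n
  proof -
    have "dist (poly_op (T n) p x) (calculus (T n) f x) \<le> d * norm x"
      "dist (poly_op S p x) (calculus S f x) \<le> d * norm x"
      unfolding dist_norm using p by (auto intro!: calculus_approx T S f)
    then show ?thesis
      using N[OF that] d(2) dist_triangle[of "calculus (T n) f x" "calculus S f x" "poly_op (T n) p x"]
        dist_triangle[of "poly_op (T n) p x" "calculus S f x" "poly_op S p x"]
      by (simp add: dist_commute)
  qed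
  then show "\<exists>N. \<forall>n\<ge>N. dist (calculus (T n) f x) (calculus S f x) < e" by blast
qed

text \<open>Norm convergence is expressed by inequalities that hold for all vectors at once, which lets the
  proofs run parallel to the strong case.\<close>

lemma poly_op_diff_eventually_le:
  assumes T: "\<And>n. positive_contraction (T n)" and S: "positive_contraction S"
    and lim: "\<And>e. 0 < e \<Longrightarrow> \<forall>\<^sub>F n in sequentially. \<forall>x. norm (T n x - S x) \<le> e * norm x"
    and "0 < e"
  shows "\<forall>\<^sub>F n in sequentially. \<forall>x. norm (poly_op (T n) p x - poly_op S p x) \<le> e * norm x"
  using \<open>0 < e\<close>
proof (induction p arbitrary: e)
  case (pCons a p)
  have l: "linear (T n)" for n by (rule positive_contraction_linear[OF T])
  have lS: "linear S" by (rule positive_contraction_linear[OF S])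
  have "bounded_linear (poly_op S p)"
    using bounded_clinear_poly_op[of S p] S by (simp add: bounded_clinear_def positive_contraction_def)
  then obtain K where K: "0 < K" "\<And>x. norm (poly_op S p x) \<le> norm x * K"
    using bounded_linear.pos_bounded by blast
  have "\<forall>\<^sub>F n in sequentially. \<forall>x. norm (poly_op (T n) p x - poly_op S p x) \<le> e / 2 * norm x"
    using pCons.prems by (intro pCons.IH) simp
  moreover have "\<forall>\<^sub>F n in sequentially. \<forall>x. norm (T n x - S x) \<le> e / (2 * K) * norm x"
    using pCons K by (intro lim) simp
  ultimately show ?case
  proof eventually_elim
    case (elim n)
    show ?case
    proof
      fix x
      have "poly_op (T n) (pCons a p) x - poly_op S (pCons a p) x
          = T n (poly_op (T n) p x - poly_op S p x) + (T n (poly_op S p x) - S (poly_op S p x))"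
        by (simp add: poly_op_pCons[OF l] poly_op_pCons[OF lS] linear_diff[OF l])
      also have "norm \<dots> \<le> norm (poly_op (T n) p x - poly_op S p x) + norm (T n (poly_op S p x) - S (poly_op S p x))"
        by (intro order_trans[OF norm_triangle_ineq] add_mono norm_positive_contraction_le T order_refl)
      also have "\<dots> \<le> e / 2 * norm x + e / (2 * K) * (norm x * K)"
      proof (intro add_mono)
        show "norm (T n (poly_op S p x) - S (poly_op S p x)) \<le> e / (2 * K) * (norm x * K)"
          by (rule order_trans[OF elim(2)[rule_format] mult_left_mono[OF K(2)]]) (use K pCons in simp)
      qed (use elim in blast)
      also have "\<dots> = e * norm x" using K by (simp add: field_simps)
      finally show "norm (poly_op (T n) (pCons a p) x - poly_op S (pCons a p) x) \<le> e * norm x" .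
    qed
  qed
qed simp

lemma calculus_diff_eventually_le:
  assumes T: "\<And>n. positive_contraction (T n)" and S: "positive_contraction S"
    and lim: "\<And>e. 0 < e \<Longrightarrow> \<forall>\<^sub>F n in sequentially. \<forall>x. norm (T n x - S x) \<le> e * norm x"
    and f: "continuous_on {0..1} f" and "0 < e"
  shows "\<forall>\<^sub>F n in sequentially. \<forall>x. norm (calculus (T n) f x - calculus S f x) \<le> e * norm x"
proof -
  obtain p where p: "\<And>u. 0 \<le> u \<Longrightarrow> u \<le> 1 \<Longrightarrow> \<bar>poly p u - f u\<bar> \<le> e / 3"
    using polynomial_approx[OF f, of "e / 3"] \<open>0 < e\<close> by auto
  have "\<forall>\<^sub>F n in sequentially. \<forall>x. norm (poly_op (T n) p x - poly_op S p x) \<le> e / 3 * norm x"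
    using \<open>0 < e\<close> by (intro poly_op_diff_eventually_le T S lim) auto
  then show ?thesis
  proof eventually_elim
    case (elim n)
    show ?case
    proof
      fix x
      have "norm (poly_op (T n) p x - calculus (T n) f x) \<le> e / 3 * norm x"
        "norm (poly_op S p x - calculus S f x) \<le> e / 3 * norm x"
        using p by (blast intro: calculus_approx T S f)+
      moreover have "norm (poly_op (T n) p x - poly_op S p x) \<le> e / 3 * norm x" using elim by blast
      moreover have "norm (calculus (T n) f x - calculus S f x) \<le>
          norm (poly_op (T n) p x - calculus (T n) f x) + norm (poly_op (T n) p x - poly_op S p x)
          + norm (poly_op S p x - calculus S f x)"
        using dist_triangle[of "calculus (T n) f x" "calculus S f x" "poly_op (T n) p x"]
          dist_triangle[of "poly_op (T n) p x" "calculus S f x" "poly_op S p x"]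
        by (simp add: dist_norm norm_minus_commute[of "calculus (T n) f x" "poly_op (T n) p x"])
      ultimately show "norm (calculus (T n) f x - calculus S f x) \<le> e * norm x" by linarith
    qed
  qed
qed

section \<open>Euler's limit for the exponential function\<close>

lemma abs_exp_minus_one_le: "\<bar>exp (d::real) - 1\<bar> \<le> exp \<bar>d\<bar> - 1"
proof (cases "0 \<le> d")
  case False
  have "2 \<le> exp d + exp (- d)"
    using cosh_real_ge_1[of d] by (simp add: cosh_field_def)
  moreover have "exp d \<le> 1" using False by simp
  ultimately show ?thesis using False by (simp add: abs_if)
qed simp

text \<open>For large \<open>s\<close> both the approximation and the exponential are small: by Bernoulli's inequality
  each lies between \<open>0\<close> and \<open>1 / (1 + s)\<close>.\<close>

lemma euler_error_large:
  assumes "0 < s" "0 < n"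
  shows "\<bar>inverse ((1 + s / real n) ^ n) - exp (- s)\<bar> \<le> inverse (1 + s)"
proof -
  have "0 \<le> s / real n" using assms by simp
  then have "- 1 \<le> s / real n" by linarith
  then have "1 + s \<le> (1 + s / real n) ^ n"
    using Bernoulli_inequality[of "s / real n" n] assms by simp
  then have "inverse ((1 + s / real n) ^ n) \<le> inverse (1 + s)"
    using assms by (intro le_imp_inverse_le) auto
  moreover have "0 \<le> inverse ((1 + s / real n) ^ n)" using assms by simp
  moreover have "exp (- s) \<le> inverse (1 + s)"
    unfolding exp_minus using assms exp_ge_add_one_self[of s] by (intro le_imp_inverse_le) auto
  moreover have "0 < exp (- s)" by simp
  ultimately show ?thesis by linarith
qed

text \<open>The logarithms \<open>n ln (1 + s / n)\<close> and \<open>s\<close> differ by at most \<open>2 s\<^sup>2 / n\<close>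
  as soon as \<open>\<bar>s\<bar> \<le> n / 2\<close>.\<close>

lemma euler_error_bounded:
  assumes s: "\<bar>s\<bar> \<le> b" and n: "2 * b \<le> real n" "0 < n"
  shows "\<bar>inverse ((1 + s / real n) ^ n) - exp (- s)\<bar> \<le> exp (- s) * (exp (2 * b\<^sup>2 / real n) - 1)"
proof -
  define x where "x = s / real n"
  have nx: "real n * x = s" using n by (simp add: x_def)
  have x: "\<bar>x\<bar> \<le> 1 / 2" using s n by (simp add: x_def abs_divide divide_le_eq)
  then have "0 < 1 + x" by linarith
  define d where "d = s - real n * ln (1 + x)"
  have "(1 + x) ^ n = exp (s - d)"
    using \<open>0 < 1 + x\<close> by (simp add: d_def exp_of_nat_mult)
  then have "inverse ((1 + x) ^ n) = exp (- s) * exp d"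
    by (simp flip: exp_minus exp_add)
  then have eq: "inverse ((1 + x) ^ n) - exp (- s) = exp (- s) * (exp d - 1)"
    by (simp add: right_diff_distrib)
  have "d = - (real n * (ln (1 + x) - x))"
    unfolding d_def right_diff_distrib nx by simp
  then have "\<bar>d\<bar> = real n * \<bar>ln (1 + x) - x\<bar>"
    by (simp add: abs_mult)
  also have "\<dots> \<le> real n * (2 * x\<^sup>2)"
    using abs_ln_one_plus_x_minus_x_bound[OF x] by (intro mult_left_mono) auto
  also have "\<dots> = 2 * s\<^sup>2 / real n" using n by (simp add: x_def power2_eq_square)
  also have "\<dots> \<le> 2 * b\<^sup>2 / real n"
    using power_mono[OF s, of 2] by (intro divide_right_mono) auto
  finally have "exp \<bar>d\<bar> \<le> exp (2 * b\<^sup>2 / real n)" by simp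
  then have "\<bar>exp d - 1\<bar> \<le> exp (2 * b\<^sup>2 / real n) - 1"
    using abs_exp_minus_one_le[of d] by linarith
  then show ?thesis
    unfolding x_def[symmetric] eq abs_mult by (simp add: mult_left_mono)
qed

lemma uniform_limit_euler:
  "uniform_limit {a..} (\<lambda>n s. inverse ((1 + s / real n) ^ n)) (\<lambda>s. exp (- s)) sequentially"
proof (rule uniform_limitI)
  fix e :: real assume e: "0 < e"
  \<comment> \<open>For \<open>s > 1 / e\<close> the error is at most \<open>1 / (1 + s) < e\<close>; the other \<open>s\<close> satisfy \<open>\<bar>s\<bar> \<le> b\<close>.\<close>
  define b where "b = max \<bar>a\<bar> (1 / e)"
  have b: "\<bar>a\<bar> \<le> b" "1 / e \<le> b" by (auto simp: b_def)
  have "(\<lambda>n. exp \<bar>a\<bar> * (exp (2 * b\<^sup>2 / real n) - 1)) \<longlonglongrightarrow> exp \<bar>a\<bar> * (exp 0 - 1)"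
    by (intro tendsto_intros lim_const_over_n)
  then have "\<forall>\<^sub>F n in sequentially. exp \<bar>a\<bar> * (exp (2 * b\<^sup>2 / real n) - 1) < e"
    by (rule order_tendstoD(2)) (simp add: e)
  moreover have "\<forall>\<^sub>F n in sequentially. 2 * b < real n" by real_asymp
  ultimately show "\<forall>\<^sub>F n in sequentially. \<forall>s\<in>{a..}. dist (inverse ((1 + s / real n) ^ n)) (exp (- s)) < e"
    using eventually_gt_at_top[of 0]
  proof eventually_elim
    case (elim n)
    show ?case
    proof
      fix s assume "s \<in> {a..}"
      then have s: "a \<le> s" by simp
      show "dist (inverse ((1 + s / real n) ^ n)) (exp (- s)) < e"
      proof (cases "1 / e < s")
        case True
        have "0 < 1 / e" using e by simp
        with True have "0 < s" by linarith
        have "inverse (1 + s) < inverse (1 / e)"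
          using True \<open>0 < 1 / e\<close> by (intro less_imp_inverse_less) auto
        then show ?thesis
          using euler_error_large[OF \<open>0 < s\<close> elim(3)] by (simp add: dist_real_def)
      next
        case False
        then have "\<bar>s\<bar> \<le> b" using s b by linarith
        then have "\<bar>inverse ((1 + s / real n) ^ n) - exp (- s)\<bar> \<le> exp (- s) * (exp (2 * b\<^sup>2 / real n) - 1)"
          using elim by (intro euler_error_bounded) auto
        also have "\<dots> \<le> exp \<bar>a\<bar> * (exp (2 * b\<^sup>2 / real n) - 1)"
          using s by (intro mult_right_mono) auto
        finally show ?thesis using elim(1) by (simp add: dist_real_def)
      qed
    qed
  qed
qed

text \<open>In the variable \<open>u = 1 / (\<lambda> + \<omega> + 1)\<close> this is \<open>1 / (1 + h \<lambda>)\<close>, written without division by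
  \<open>u\<close> so that, for \<open>h > 0\<close>, it is continuous at \<open>0\<close>.\<close>

definition euler_symbol :: "real \<Rightarrow> real \<Rightarrow> real \<Rightarrow> real" where
  "euler_symbol \<omega> h u = u / ((1 - h * \<omega>) * u + h * (1 - u))"

text \<open>In the same variable this is \<open>exp (- t \<lambda>)\<close>; its value at \<open>0\<close> is the limit for
  \<open>\<lambda> \<longlonglongrightarrow> \<infinity>\<close>.\<close>

definition exp_symbol :: "real \<Rightarrow> real \<Rightarrow> real \<Rightarrow> real" where
  "exp_symbol \<omega> t u = (if u = 0 then 0 else exp (- (t * (1 / u - 1 - \<omega>))))"

lemma euler_symbol_denominator_pos:
  assumes "0 < h" "h * \<omega> < 1" "0 \<le> u" "u \<le> (1::real)"
  shows "0 < (1 - h * \<omega>) * u + h * (1 - u)"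
proof (cases "u = 1")
  case False
  then have "0 < h * (1 - u)" using assms by simp
  then show ?thesis using assms by (intro add_nonneg_pos) auto
qed (use assms in simp)

lemma continuous_on_euler_symbol:
  assumes "0 < h" "h * \<omega> < 1"
  shows "continuous_on {0..1} (euler_symbol \<omega> h)"
  unfolding euler_symbol_def
  using euler_symbol_denominator_pos[OF assms]
  by (intro continuous_intros) (force simp: less_imp_neq[symmetric])

lemma eventually_euler_step:
  assumes "0 < t"
  shows "\<forall>\<^sub>F n in sequentially. 0 < t / real n \<and> t / real n * \<omega> < 1"
proof -
  have "(\<lambda>n. t / real n * \<omega>) \<longlonglongrightarrow> 0" by real_asymp
  then have "\<forall>\<^sub>F n in sequentially. t / real n * \<omega> < 1" by (rule order_tendstoD(2)) simp
  with eventually_gt_at_top[of 0] show ?thesis by eventually_elim (use assms in simp)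
qed

lemma uniform_limit_euler_symbol:
  assumes t: "0 < t"
  shows "uniform_limit {0..1} (\<lambda>n u. euler_symbol \<omega> (t / real n) u ^ n) (exp_symbol \<omega> t) sequentially"
proof (rule uniform_limitI)
  fix e :: real assume "0 < e"
  from eventually_gt_at_top[of 0] uniform_limitD[OF uniform_limit_euler[of "- (t * \<omega>)"] this]
  show "\<forall>\<^sub>F n in sequentially. \<forall>u\<in>{0..1}. dist (euler_symbol \<omega> (t / real n) u ^ n) (exp_symbol \<omega> t u) < e"
  proof eventually_elim
    case (elim n)
    show ?case
    proof
      fix u :: real assume u: "u \<in> {0..1}"
      show "dist (euler_symbol \<omega> (t / real n) u ^ n) (exp_symbol \<omega> t u) < e"
      proof (cases "u = 0")
        case True
        then show ?thesis using elim(1) \<open>0 < e\<close> by (simp add: euler_symbol_def exp_symbol_def zero_power)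
      next
        case False
        define s where "s = t * (1 / u - 1 - \<omega>)"
        have "0 \<le> t * (1 / u - 1)" using u False t by (intro mult_nonneg_nonneg) auto
        then have s: "s \<in> {- (t * \<omega>)..}" by (simp add: s_def right_diff_distrib)
        have "(1 - t / real n * \<omega>) * u + t / real n * (1 - u) = u * (1 + s / real n)"
          using False elim(1) by (simp add: s_def field_simps)
        then have "euler_symbol \<omega> (t / real n) u ^ n = inverse ((1 + s / real n) ^ n)"
          using False by (simp add: euler_symbol_def inverse_eq_divide power_one_over)
        moreover have "exp_symbol \<omega> t u = exp (- s)" using False by (simp add: exp_symbol_def s_def)
        ultimately show ?thesis using elim(2) s by simp
      qed
    qed
  qed
qed

lemma continuous_on_exp_symbol:
  assumes t: "0 < t"
  shows "continuous_on {0..1} (exp_symbol \<omega> t)"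
proof (rule uniform_limit_theorem[OF _ uniform_limit_euler_symbol[OF t]])
  show "\<forall>\<^sub>F n in sequentially. continuous_on {0..1} (\<lambda>u. euler_symbol \<omega> (t / real n) u ^ n)"
    using eventually_euler_step[OF t]
    by eventually_elim (intro continuous_on_power continuous_on_euler_symbol, auto)
qed simp

section \<open>Resolvents of graphs\<close>

lemma mem_graph_shift: "(x, y) \<in> graph_shift A c \<longleftrightarrow> (x, y - c *\<^sub>C x) \<in> A"
  unfolding graph_shift_def by (auto intro!: exI[of _ "y - c *\<^sub>C x"])

lemma graph_shift_shift: "graph_shift (graph_shift A c) d = graph_shift A (c + d)"
  by (auto simp: mem_graph_shift scaleC_add_left algebra_simps)

lemma csubspace_graphD:
  fixes A :: "('a::complex_vector \<times> 'a) set"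
  assumes "csubspace A"
  shows "(0, 0) \<in> A" and "(x, y) \<in> A \<Longrightarrow> (u, v) \<in> A \<Longrightarrow> (x + u, y + v) \<in> A"
    and "(x, y) \<in> A \<Longrightarrow> (c *\<^sub>C x, c *\<^sub>C y) \<in> A"
    and "(x, y) \<in> A \<Longrightarrow> (u, v) \<in> A \<Longrightarrow> (x - u, y - v) \<in> A"
proof -
  show zero: "(0, 0) \<in> A"
    using assms by (simp add: csubspace_def zero_prod_def)
  show add: "(x + u, y + v) \<in> A" if "(x, y) \<in> A" "(u, v) \<in> A" for x y u v
    using assms that unfolding csubspace_def by (metis add_Pair)
  show scale: "(c *\<^sub>C x, c *\<^sub>C y) \<in> A" if "(x, y) \<in> A" for c x y
    using assms that unfolding csubspace_def scaleC_prod_def by (metis fst_conv snd_conv)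
  have minus: "(-1) *\<^sub>C w = - w" for w :: 'a
    using scaleR_scaleC[of "-1" w] by simp
  show "(x - u, y - v) \<in> A" if "(x, y) \<in> A" "(u, v) \<in> A"
    using add[OF that(1) scale[OF that(2), of "-1"]] by (simp add: minus)
qed

lemma csubspace_graph_shift:
  assumes "csubspace A"
  shows "csubspace (graph_shift A c)"
  unfolding csubspace_def
proof (intro conjI ballI allI)
  show "0 \<in> graph_shift A c"
    using csubspace_graphD(1)[OF assms] by (simp add: zero_prod_def mem_graph_shift scaleC_zero_right)
next
  fix p q assume pq: "p \<in> graph_shift A c" "q \<in> graph_shift A c"
  obtain x y u v where [simp]: "p = (x, y)" "q = (u, v)" by fastforce
  show "p + q \<in> graph_shift A c"
    using pq csubspace_graphD(2)[OF assms, of x "y - c *\<^sub>C x" u "v - c *\<^sub>C u"]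
    by (simp add: mem_graph_shift scaleC_add_right algebra_simps)
next
  fix d p assume p: "p \<in> graph_shift A c"
  obtain x y where [simp]: "p = (x, y)" by fastforce
  have "d *\<^sub>C y - c *\<^sub>C d *\<^sub>C x = d *\<^sub>C (y - c *\<^sub>C x)"
    by (simp add: scaleC_diff_right scaleC_scaleC mult.commute)
  then show "d *\<^sub>C p \<in> graph_shift A c"
    using p csubspace_graphD(3)[OF assms, of x "y - c *\<^sub>C x" d]
    by (simp add: mem_graph_shift scaleC_prod_def)
qed

lemma graph_inverse_iff:
  assumes "\<And>y. \<exists>!x. (x, y) \<in> B"
  shows "(x, y) \<in> B \<longleftrightarrow> x = graph_inverse B y"
  unfolding graph_inverse_def using theI'[OF assms[of y]] assms[of y] by blast

lemma surj_graph_ex1: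
  fixes B :: "('a::complex_inner \<times> 'a) set"
  assumes sub: "csubspace B" and surj: "Range B = UNIV"
    and bnd: "\<And>x y. (x, y) \<in> B \<Longrightarrow> norm x \<le> K * norm y"
  shows "\<exists>!x. (x, y) \<in> B"
proof -
  obtain x where "(x, y) \<in> B" using surj by blast
  moreover have "x = u" if "(x, y) \<in> B" "(u, y) \<in> B" for x u
    using bnd[OF csubspace_graphD(4)[OF sub that]] by simp
  ultimately show ?thesis by blast
qed

lemma graph_inverse_linear:
  assumes sub: "csubspace B" and ex1: "\<And>y. \<exists>!x. (x, y) \<in> B"
  shows "graph_inverse B (x + y) = graph_inverse B x + graph_inverse B y"
    and "graph_inverse B (c *\<^sub>C x) = c *\<^sub>C graph_inverse B x"
    and "graph_inverse B (x - y) = graph_inverse B x - graph_inverse B y"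
  using csubspace_graphD(2-4)[OF sub] graph_inverse_iff[OF ex1] by metis+

text \<open>A Neumann series argument in fixed-point form: \<open>x = B\<^sup>-\<^sup>1 (y - d x)\<close> is a contraction
  equation.\<close>

lemma surj_graph_shift:
  fixes B :: "('a::chilbert_space \<times> 'a) set"
  assumes sub: "csubspace B" and surj: "Range B = UNIV"
    and bnd: "\<And>x y. (x, y) \<in> B \<Longrightarrow> norm x \<le> K * norm y"
    and K: "0 \<le> K" "cmod d * K < 1"
  shows "Range (graph_shift B d) = UNIV"
proof -
  have ex1: "\<exists>!x. (x, y) \<in> B" for y by (rule surj_graph_ex1[OF sub surj bnd])
  note R = graph_inverse_linear[OF sub ex1] graph_inverse_iff[OF ex1]
  have "\<exists>x. (x, y) \<in> graph_shift B d" for y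
  proof -
    define f where "f x = graph_inverse B (y - d *\<^sub>C x)" for x
    have "dist (f x) (f u) \<le> cmod d * K * dist x u" for x u
    proof -
      have "f x - f u = graph_inverse B (d *\<^sub>C (u - x))"
        unfolding f_def R(3)[symmetric] by (simp add: scaleC_diff_right)
      then have "norm (f x - f u) \<le> K * norm (d *\<^sub>C (u - x))"
        using bnd R(4) by metis
      then show ?thesis by (simp add: dist_norm norm_scaleC mult_ac norm_minus_commute[of x u])
    qed
    then have "\<exists>!x. f x = x"
      using K by (intro banach_fix_type[of "cmod d * K"]) auto
    then obtain x where "f x = x" by blast
    then have "(x, y - d *\<^sub>C x) \<in> B" using R(4) unfolding f_def by metis
    then show ?thesis by (auto simp: mem_graph_shift)
  qed
  then show ?thesis by blast
qed

lemma Im_cinner_commute: "Im (cinner x y) = - Im (cinner y (x::'a::complex_inner))"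
  by (subst cinner_commute) simp

lemma self_adjoint_graph_real:
  assumes "self_adjoint_graph A" "(x, y) \<in> A"
  shows "Im (cinner x y) = 0"
  using assms by (auto simp: self_adjoint_graph_def complex_is_Real_iff)

text \<open>Reality of the form at \<open>x + i u\<close> is symmetry of the graph.\<close>

lemma self_adjoint_graph_symmetric:
  assumes A: "self_adjoint_graph A" and "(x, a) \<in> A" "(u, b) \<in> A"
  shows "re_inner x b = re_inner a u"
proof -
  have sub: "csubspace A" using A by (simp add: self_adjoint_graph_def)
  have "(x + \<i> *\<^sub>C u, a + \<i> *\<^sub>C b) \<in> A"
    by (intro csubspace_graphD(2,3)[OF sub] assms)
  then have "Im (cinner (x + \<i> *\<^sub>C u) (a + \<i> *\<^sub>C b)) = 0"
    by (rule self_adjoint_graph_real[OF A])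
  moreover have "cinner z (a + \<i> *\<^sub>C b) = cinner z a - \<i> * cinner z b" for z
    by (subst (1 2 3) cinner_commute) (simp add: cinner_add_left cinner_scaleC_left)
  ultimately have "Re (cinner u a) = Re (cinner x b)"
    using self_adjoint_graph_real[OF A assms(2)] self_adjoint_graph_real[OF A assms(3)]
    by (simp add: cinner_add_left cinner_scaleC_left)
  then show ?thesis by (metis re_inner_commute re_inner_def)
qed

text \<open>The vectors \<open>y - i s x\<close> and \<open>i s x\<close> are orthogonal for the real inner product, since the
  form of a self-adjoint graph is real.\<close>

lemma self_adjoint_graph_norm_shift:
  assumes A: "self_adjoint_graph A" and "(x, y) \<in> graph_shift A (Complex c s)"
  shows "(norm y)\<^sup>2 = (norm (y - (\<i> * of_real s) *\<^sub>C x))\<^sup>2 + s\<^sup>2 * (norm x)\<^sup>2"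
proof -
  define v where "v = y - (\<i> * of_real s) *\<^sub>C x"
  define a where "a = y - Complex c s *\<^sub>C x"
  have "(x, a) \<in> A" using assms by (simp add: mem_graph_shift a_def)
  then have "Im (cinner a x) = 0"
    using self_adjoint_graph_real[OF A] Im_cinner_commute[of a x] by simp
  moreover have "Im (cinner x x) = 0"
    using Im_cinner_commute[of x x] by simp
  moreover have "v = a + complex_of_real c *\<^sub>C x"
    by (simp add: v_def a_def Complex_eq scaleC_add_left)
  ultimately have "Im (cinner v x) = 0"
    by (simp add: cinner_add_left cinner_scaleC_left)
  then have "Im (cinner x v) = 0"
    using Im_cinner_commute[of x v] by simp
  then have *: "re_inner ((\<i> * of_real s) *\<^sub>C x) v = 0"
    by (simp add: re_inner_def cinner_scaleC_left)
  have y: "y = v + (\<i> * of_real s) *\<^sub>C x" by (simp add: v_def)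
  have "(norm y)\<^sup>2 = (norm v)\<^sup>2 + (norm ((\<i> * of_real s) *\<^sub>C x))\<^sup>2"
    unfolding power2_norm_re_inner y re_inner_add_left re_inner_add_right
    using * re_inner_commute[of v "(\<i> * of_real s) *\<^sub>C x"] by linarith
  then show ?thesis
    by (simp add: v_def norm_scaleC norm_mult power_mult_distrib)
qed

text \<open>The shift exceeds \<open>\<omega>\<close> by \<open>1\<close>; this normalization makes the resolvent a contraction.\<close>

definition shifted_resolvent :: "real \<Rightarrow> ('a::complex_inner \<times> 'a) set \<Rightarrow> 'a \<Rightarrow> 'a" where
  "shifted_resolvent \<omega> A = graph_inverse (graph_shift A (of_real (\<omega> + 1)))"

lemma bounded_below_shift:
  assumes below: "\<And>x y. (x, y) \<in> A \<Longrightarrow> 0 \<le> re_inner x y + \<omega> * (norm x)\<^sup>2"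
    and "(x, y) \<in> graph_shift A (of_real (\<omega> + 1))"
  shows "(norm x)\<^sup>2 \<le> re_inner x y"
proof -
  have "(x, y - (\<omega> + 1) *\<^sub>R x) \<in> A"
    using assms(2) by (simp add: mem_graph_shift scaleR_scaleC)
  from below[OF this] show ?thesis
    by (simp add: re_inner_linear power2_norm_re_inner algebra_simps)
qed

lemma norm_sq_le_of_re_inner:
  assumes "(norm x)\<^sup>2 \<le> re_inner x y"
  shows "(norm x)\<^sup>2 \<le> (norm y)\<^sup>2"
proof -
  have "0 \<le> (norm (y - x))\<^sup>2" by simp
  then show ?thesis
    using assms unfolding power2_norm_re_inner
    by (simp add: re_inner_linear re_inner_commute[of y x])
qed

text \<open>Surjectivity is only known on the imaginary axis. Each shift moves the spectral parameter by
  less than the lower bound available at its starting point: from \<open>i s\<close> the bound is \<open>\<bar>s\<bar>\<close>, which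
  suffices for a step of length \<open>\<bar>\<omega> + 1\<bar> < s\<close>, and at \<open>\<omega> + 1 + i s\<close> it is \<open>sqrt (1 + s\<^sup>2)\<close>, which
  suffices for the step of length \<open>s\<close> down to the real axis.\<close>

lemma surj_real_shift:
  fixes A :: "('a::chilbert_space \<times> 'a) set"
  assumes A: "self_adjoint_graph A"
    and below: "\<And>x y. (x, y) \<in> A \<Longrightarrow> 0 \<le> re_inner x y + \<omega> * (norm x)\<^sup>2"
  shows "Range (graph_shift A (of_real (\<omega> + 1))) = UNIV"
proof -
  define c where "c = \<omega> + 1"
  define s where "s = \<bar>c\<bar> + 1"
  have s: "0 < s" "\<bar>c\<bar> < s" by (auto simp: s_def)
  have sub: "csubspace (graph_shift A d)" for d
    using A by (intro csubspace_graph_shift) (simp add: self_adjoint_graph_def)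
  have "Range (graph_shift (graph_shift A (Complex 0 s)) (of_real c)) = UNIV"
  proof (rule surj_graph_shift[OF sub])
    have "Complex 0 s = \<i> * of_real s" by (simp add: Complex_eq)
    then show "Range (graph_shift A (Complex 0 s)) = UNIV"
      using A s by (simp add: self_adjoint_graph_def)
    show "norm x \<le> inverse s * norm y" if "(x, y) \<in> graph_shift A (Complex 0 s)" for x y
    proof -
      have "(s * norm x)\<^sup>2 \<le> (norm y)\<^sup>2"
        using self_adjoint_graph_norm_shift[OF A that] by (simp add: power_mult_distrib)
      then have "s * norm x \<le> norm y" by (rule power2_le_imp_le) simp
      then show ?thesis using s by (simp add: field_simps)
    qed
    show "cmod (of_real c) * inverse s < 1" using s by (simp add: field_simps)
  qed (use s in simp)
  then have surj: "Range (graph_shift A (Complex c s)) = UNIV"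
    by (simp add: graph_shift_shift Complex_eq add.commute)
  have "Range (graph_shift (graph_shift A (Complex c s)) (Complex 0 (- s))) = UNIV"
  proof (rule surj_graph_shift[OF sub surj])
    show "norm x \<le> inverse (sqrt (1 + s\<^sup>2)) * norm y" if xy: "(x, y) \<in> graph_shift A (Complex c s)" for x y
    proof -
      define v where "v = y - (\<i> * of_real s) *\<^sub>C x"
      have "(x, v) \<in> graph_shift A (of_real c)"
        using xy by (simp add: mem_graph_shift v_def Complex_eq scaleC_add_left algebra_simps)
      then have "(norm x)\<^sup>2 \<le> (norm v)\<^sup>2"
        by (intro norm_sq_le_of_re_inner bounded_below_shift[OF below]) (simp_all add: c_def)
      then have "(sqrt (1 + s\<^sup>2) * norm x)\<^sup>2 \<le> (norm y)\<^sup>2"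
        using self_adjoint_graph_norm_shift[OF A xy]
        by (simp add: power_mult_distrib v_def distrib_right)
      then have "sqrt (1 + s\<^sup>2) * norm x \<le> norm y" by (rule power2_le_imp_le) simp
      moreover have "0 < sqrt (1 + s\<^sup>2)" by (simp add: add_pos_nonneg)
      ultimately show ?thesis by (simp add: field_simps)
    qed
    have "s < sqrt (1 + s\<^sup>2)" by (rule real_less_rsqrt) simp
    moreover from this s have "0 < sqrt (1 + s\<^sup>2)" by linarith
    ultimately show "cmod (Complex 0 (- s)) * inverse (sqrt (1 + s\<^sup>2)) < 1"
      using s by (simp add: complex_norm inverse_eq_divide divide_less_eq)
  qed simp
  moreover have "Complex c s + Complex 0 (- s) = of_real (\<omega> + 1)"
    by (simp add: c_def complex_eq_iff)
  ultimately show ?thesis by (simp add: graph_shift_shift)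
qed

lemma
  fixes A :: "('a::chilbert_space \<times> 'a) set"
  assumes A: "self_adjoint_graph A"
    and below: "\<And>x y. (x, y) \<in> A \<Longrightarrow> 0 \<le> re_inner x y + \<omega> * (norm x)\<^sup>2"
  shows shifted_resolvent_iff: "(x, y) \<in> graph_shift A (of_real (\<omega> + 1)) \<longleftrightarrow> x = shifted_resolvent \<omega> A y"
    and positive_contraction_shifted_resolvent: "positive_contraction (shifted_resolvent \<omega> A)"
proof -
  define B where "B = graph_shift A (of_real (\<omega> + 1))"
  define R where "R = shifted_resolvent \<omega> A"
  have sub: "csubspace B"
    unfolding B_def using A by (intro csubspace_graph_shift) (simp add: self_adjoint_graph_def)
  have form: "(norm x)\<^sup>2 \<le> re_inner x y" if "(x, y) \<in> B" for x y
    using that bounded_below_shift[OF below] by (simp add: B_def)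
  have bnd: "norm x \<le> 1 * norm y" if "(x, y) \<in> B" for x y
    using norm_sq_le_of_re_inner[OF form[OF that]] by simp
  have ex1: "\<exists>!x. (x, y) \<in> B" for y
    using surj_graph_ex1[OF sub _ bnd] surj_real_shift[OF A below] by (simp add: B_def)
  have iff: "(x, y) \<in> B \<longleftrightarrow> x = R y" for x y
    unfolding R_def shifted_resolvent_def B_def[symmetric] by (rule graph_inverse_iff[OF ex1])
  then show "(x, y) \<in> graph_shift A (of_real (\<omega> + 1)) \<longleftrightarrow> x = shifted_resolvent \<omega> A y"
    unfolding R_def B_def .
  have R: "(R y, y) \<in> B" for y using iff by blast
  have lin: "R (y + z) = R y + R z" "R (c *\<^sub>C y) = c *\<^sub>C R y" for y z c
    using graph_inverse_linear[OF sub ex1] by (simp_all add: R_def shifted_resolvent_def B_def)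
  have "norm (R y) \<le> norm y * 1" for y using bnd[OF R[of y]] by simp
  then have "bounded_linear R"
    by (intro bounded_linear_intro[where K = 1]) (simp_all only: lin scaleR_scaleC)
  moreover have "re_inner (R y) z = re_inner y (R z)" for y z
  proof -
    have "(R w, w - (\<omega> + 1) *\<^sub>R R w) \<in> A" for w
      using R[of w] by (simp add: B_def mem_graph_shift scaleR_scaleC)
    from self_adjoint_graph_symmetric[OF A this[of y] this[of z]]
    show ?thesis by (simp add: re_inner_linear)
  qed
  ultimately show "positive_contraction (shifted_resolvent \<omega> A)"
    using lin form[OF R] by (simp add: positive_contraction_def bounded_clinear_def flip: R_def)
qed

section \<open>The exponential as a function of the resolvent\<close>

text \<open>With \<open>z = a + (\<omega> + 1) x\<close> the condition \<open>(x, a) \<in> A\<close> reads \<open>x = R z\<close>, and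
  \<open>y = x + h a\<close> becomes \<open>y = D(R) z\<close> for the linear polynomial \<open>D\<close> in the denominator of the
  symbol. As \<open>D > 0\<close> on \<open>[0, 1]\<close>, the calculus inverts \<open>D(R)\<close>.\<close>

lemma graph_inverse_one_plus_graph:
  fixes A :: "('a::chilbert_space \<times> 'a) set"
  assumes A: "self_adjoint_graph A"
    and below: "\<And>x y. (x, y) \<in> A \<Longrightarrow> 0 \<le> re_inner x y + \<omega> * (norm x)\<^sup>2"
    and h: "0 < h" "h * \<omega> < 1"
  shows "graph_inverse (one_plus_graph h A) = calculus (shifted_resolvent \<omega> A) (euler_symbol \<omega> h)"
proof -
  define c where "c = \<omega> + 1"
  define R where "R = shifted_resolvent \<omega> A"
  have R: "positive_contraction R"
    unfolding R_def using A below by (rule positive_contraction_shifted_resolvent)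
  have l: "linear R" by (rule positive_contraction_linear[OF R])
  have mem: "(x, a) \<in> A \<longleftrightarrow> x = R (a + c *\<^sub>R x)" for x a
    using shifted_resolvent_iff[OF A below, of x "a + c *\<^sub>R x"]
    by (simp add: R_def c_def mem_graph_shift scaleR_scaleC)
  define D where "D = [:h, 1 - h * c:]"
  have D_eq: "poly D u = (1 - h * \<omega>) * u + h * (1 - u)" for u
    by (simp add: D_def c_def algebra_simps)
  have D_pos: "0 < poly D u" if "0 \<le> u" "u \<le> 1" for u
    unfolding D_eq by (rule euler_symbol_denominator_pos[OF h that])
  define s where "s u = 1 / poly D u" for u
  have s: "continuous_on {0..1} s"
    unfolding s_def using D_pos by (intro continuous_intros) (force simp: less_imp_neq[symmetric])
  have opD: "poly_op R D z = h *\<^sub>R z + (1 - h * c) *\<^sub>R R z" for z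
    by (simp add: D_def poly_op_pCons[OF l] linear_scale[OF l] linear_0[OF l])
  have one: "calculus R (\<lambda>u. f u * g u) z = z" if "\<And>u. 0 \<le> u \<Longrightarrow> u \<le> 1 \<Longrightarrow> f u * g u = 1" for f g z
    using calculus_cong[of "\<lambda>u. f u * g u" "poly 1" R z] that calculus_poly[OF R, of 1 z]
    by (simp add: poly_op_1[OF l])
  have Ds: "poly_op R D (calculus R s y) = y" for y
    using calculus_mult[OF R _ s, of "poly D" y] one[of "poly D" s y] D_pos
    by (simp add: calculus_poly[OF R] continuous_on_poly s_def less_imp_neq[symmetric])
  have sD: "calculus R s (poly_op R D z) = z" for z
    using calculus_mult[OF R s, of "poly D" z] one[of s "poly D" z] D_pos
    by (simp add: calculus_poly[OF R] continuous_on_poly s_def less_imp_neq[symmetric])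
  have g: "calculus R (euler_symbol \<omega> h) y = R (calculus R s y)" for y
  proof -
    have "euler_symbol \<omega> h = (\<lambda>u. poly [:0, 1:] u * s u)"
      by (simp add: euler_symbol_def s_def D_eq fun_eq_iff)
    then have "calculus R (euler_symbol \<omega> h) y = calculus R (poly [:0, 1:]) (calculus R s y)"
      using calculus_mult[OF R _ s, of "poly [:0, 1:]" y] by (simp only: continuous_on_poly[OF continuous_on_id])
    then show ?thesis by (simp only: calculus_poly[OF R]) (simp add: poly_op_pCons[OF l] linear_0[OF l])
  qed
  have step: "x + h *\<^sub>R a = poly_op R D (a + c *\<^sub>R x)" if "x = R (a + c *\<^sub>R x)" for x a
    unfolding opD that[symmetric] by (simp add: algebra_simps)
  have iff: "(x, y) \<in> one_plus_graph h A \<longleftrightarrow> x = calculus R (euler_symbol \<omega> h) y" for x y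
  proof
    assume "(x, y) \<in> one_plus_graph h A"
    then obtain a where a: "(x, a) \<in> A" "y = x + h *\<^sub>R a" by (auto simp: one_plus_graph_def)
    then have x: "x = R (a + c *\<^sub>R x)" by (simp only: mem)
    then have "calculus R s y = a + c *\<^sub>R x" unfolding a(2) step[OF x] by (rule_tac sD)
    then show "x = calculus R (euler_symbol \<omega> h) y" using g x by simp
  next
    define z where "z = calculus R s y"
    assume "x = calculus R (euler_symbol \<omega> h) y"
    then have x: "x = R z" by (simp add: g z_def)
    define a where "a = z - c *\<^sub>R x"
    have z: "z = a + c *\<^sub>R x" by (simp add: a_def)
    have "(x, a) \<in> A" using x unfolding mem z .
    moreover have "y = x + h *\<^sub>R a"
      using step[of x a] x Ds[of y] unfolding z_def[symmetric] z by simp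
    ultimately show "(x, y) \<in> one_plus_graph h A" by (auto simp: one_plus_graph_def)
  qed
  then show ?thesis
    unfolding R_def[symmetric] by (simp add: fun_eq_iff graph_inverse_def)
qed

lemma graph_exp_eq_calculus:
  fixes A :: "('a::chilbert_space \<times> 'a) set"
  assumes A: "self_adjoint_graph A"
    and below: "\<And>x y. (x, y) \<in> A \<Longrightarrow> 0 \<le> re_inner x y + \<omega> * (norm x)\<^sup>2"
    and t: "0 < t"
  shows "graph_exp t A = calculus (shifted_resolvent \<omega> A) (exp_symbol \<omega> t)"
proof
  fix x
  define R where "R = shifted_resolvent \<omega> A"
  have R: "positive_contraction R"
    unfolding R_def using A below by (rule positive_contraction_shifted_resolvent)
  have "\<forall>\<^sub>F n in sequentially. continuous_on {0..1} (\<lambda>u. euler_symbol \<omega> (t / real n) u ^ n)"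
    using eventually_euler_step[OF t]
    by eventually_elim (intro continuous_on_power continuous_on_euler_symbol, auto)
  then have lim: "(\<lambda>n. calculus R (\<lambda>u. euler_symbol \<omega> (t / real n) u ^ n) x) \<longlonglongrightarrow> calculus R (exp_symbol \<omega> t) x"
    by (rule calculus_uniform_limit[OF R _ uniform_limit_euler_symbol[OF t]])
  have "\<forall>\<^sub>F n in sequentially. calculus R (\<lambda>u. euler_symbol \<omega> (t / real n) u ^ n) x
      = (graph_inverse (one_plus_graph (t / real n) A) ^^ n) x"
    using eventually_euler_step[OF t, of \<omega>]
  proof eventually_elim
    case (elim n)
    then show ?case
      using calculus_power[OF R continuous_on_euler_symbol, of "t / real n" \<omega> n x]
        graph_inverse_one_plus_graph[OF A below, of "t / real n"] by (simp add: R_def)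
  qed
  from Lim_transform_eventually[OF lim this]
  show "graph_exp t A x = calculus (shifted_resolvent \<omega> A) (exp_symbol \<omega> t) x"
    unfolding graph_exp_def R_def by (rule limI)
qed

section \<open>Transfer of resolvent convergence to the real axis\<close>

lemma resolvent_at_iff:
  fixes A :: "('a::complex_inner \<times> 'a) set"
  assumes "self_adjoint_graph A" "s \<noteq> 0"
  shows "(x, y) \<in> graph_shift A (\<i> * of_real s) \<longleftrightarrow> x = resolvent_at A s y"
  unfolding resolvent_at_def
  using self_adjoint_resolvent(1)[OF assms] by (intro graph_inverse_iff) (simp add: graph_invertible_def)

text \<open>The resolvent identity
  \<open>(B + \<zeta>')\<^sup>-\<^sup>1 - (A + \<zeta>')\<^sup>-\<^sup>1 = (I + d (B + \<zeta>')\<^sup>-\<^sup>1) ((B + \<zeta>)\<^sup>-\<^sup>1 - (A + \<zeta>)\<^sup>-\<^sup>1) (I + d (A + \<zeta>')\<^sup>-\<^sup>1)\<close>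
  with \<open>d = \<zeta> - \<zeta>'\<close>, at \<open>\<zeta> = i s\<close> and \<open>\<zeta>' = \<omega> + 1\<close>. It moves between the two points however far
  apart they are.\<close>

lemma shifted_resolvent_diff_le:
  fixes A B :: "('a::chilbert_space \<times> 'a) set"
  assumes A: "self_adjoint_graph A" and B: "self_adjoint_graph B"
    and belowA: "\<And>x y. (x, y) \<in> A \<Longrightarrow> 0 \<le> re_inner x y + \<omega> * (norm x)\<^sup>2"
    and belowB: "\<And>x y. (x, y) \<in> B \<Longrightarrow> 0 \<le> re_inner x y + \<omega> * (norm x)\<^sup>2"
    and s: "s \<noteq> 0"
  defines "d \<equiv> \<i> * complex_of_real s - of_real (\<omega> + 1)"
  defines "z \<equiv> \<lambda>y. y + d *\<^sub>C shifted_resolvent \<omega> A y"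
  shows "norm (shifted_resolvent \<omega> B y - shifted_resolvent \<omega> A y)
    \<le> (1 + cmod d) * norm (resolvent_at B s (z y) - resolvent_at A s (z y))"
proof -
  define R where "R = shifted_resolvent \<omega> B"
  have R: "positive_contraction R"
    unfolding R_def using B belowB by (rule positive_contraction_shifted_resolvent)
  define w where "w = shifted_resolvent \<omega> A y"
  define w' where "w' = resolvent_at B s (z y)"
  have z: "z y = y + d *\<^sub>C w" by (simp add: z_def w_def)
  have shift: "(x, v + d *\<^sub>C x) \<in> graph_shift G (\<i> * of_real s) \<longleftrightarrow> (x, v) \<in> graph_shift G (of_real (\<omega> + 1))"
    for x v and G :: "('a \<times> 'a) set"
  proof -
    have "(\<i> * of_real s) *\<^sub>C x = d *\<^sub>C x + of_real (\<omega> + 1) *\<^sub>C x"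
      unfolding scaleC_add_left[symmetric] by (simp add: d_def)
    then show ?thesis by (simp add: mem_graph_shift)
  qed
  have w: "w = resolvent_at A s (z y)"
    using shifted_resolvent_iff[OF A belowA, of w y] shift[of w y A] resolvent_at_iff[OF A s, of w "z y"]
    by (simp add: w_def z)
  have "w' = R (z y - d *\<^sub>C w')"
    using shifted_resolvent_iff[OF B belowB, of w' "z y - d *\<^sub>C w'"] shift[of w' "z y - d *\<^sub>C w'" B]
      resolvent_at_iff[OF B s, of w' "z y"]
    by (simp add: w'_def R_def)
  also have "z y - d *\<^sub>C w' = y - d *\<^sub>C (w' - w)" by (simp add: z scaleC_diff_right)
  also have "R \<dots> = R y - R (d *\<^sub>C (w' - w))"
    by (rule linear_diff[OF positive_contraction_linear[OF R]])
  finally have "w' + R (d *\<^sub>C (w' - w)) = R y" unfolding eq_diff_eq .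
  then have "R y - w = (w' - w) + R (d *\<^sub>C (w' - w))" by (metis add_diff_eq add.commute)
  then have "norm (R y - w) \<le> norm (w' - w) + norm (d *\<^sub>C (w' - w))"
    by (metis norm_triangle_ineq norm_positive_contraction_le[OF R] add_left_mono order_trans)
  then show ?thesis
    by (simp add: norm_scaleC distrib_right R_def w_def flip: w) (simp add: w'_def)
qed

section \<open>Convergence of the exponentials\<close>

theorem theorem6p3:
  fixes A :: "('a::chilbert_space \<times> 'a) set"
    and An :: "nat \<Rightarrow> ('a \<times> 'a) set"
  assumes "self_adjoint_graph A"
    and "\<And>n. self_adjoint_graph (An n)"
    and "uniformly_bounded_below (insert A (range An))"
  shows "(strong_resolvent_tendsto An A \<longrightarrow>
           (\<forall>t>0. strongly_tendsto (\<lambda>n. graph_exp t (An n)) (graph_exp t A))) \<and>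
         ((\<forall>s::real. s \<noteq> 0 \<longrightarrow>
             norm_tendsto (\<lambda>n. resolvent_at (An n) s) (resolvent_at A s)) \<longrightarrow>
           (\<forall>t>0. norm_tendsto (\<lambda>n. graph_exp t (An n)) (graph_exp t A)))"
proof -
  obtain \<omega> where \<omega>: "\<And>G x y. G \<in> insert A (range An) \<Longrightarrow> (x, y) \<in> G \<Longrightarrow> 0 \<le> re_inner x y + \<omega> * (norm x)\<^sup>2"
    using assms(3) unfolding uniformly_bounded_below_def re_inner_def by blast
  have belowA: "\<And>x y. (x, y) \<in> A \<Longrightarrow> 0 \<le> re_inner x y + \<omega> * (norm x)\<^sup>2"
    and belowAn: "\<And>n x y. (x, y) \<in> An n \<Longrightarrow> 0 \<le> re_inner x y + \<omega> * (norm x)\<^sup>2"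
    using \<omega> by blast+
  define R where "R = shifted_resolvent \<omega> A"
  define Rn where "Rn n = shifted_resolvent \<omega> (An n)" for n
  have R: "positive_contraction R" and Rn: "positive_contraction (Rn n)" for n
    unfolding R_def Rn_def
    by (rule positive_contraction_shifted_resolvent, rule assms, erule belowA belowAn)+
  have exp: "graph_exp t A = calculus R (exp_symbol \<omega> t)"
    and expn: "graph_exp t (An n) = calculus (Rn n) (exp_symbol \<omega> t)" if "0 < t" for t n
    unfolding R_def Rn_def
    by (rule graph_exp_eq_calculus, rule assms, erule belowA belowAn, rule that)+
  \<comment> \<open>\<open>z s y\<close> is the vector that the resolvent of \<open>A\<close> at \<open>i s\<close> sends to \<open>R y\<close>; it depends on \<open>A\<close> only,
    so pointwise convergence at \<open>z s y\<close> can be used.\<close>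
  define z where "z s y = y + (\<i> * complex_of_real s - of_real (\<omega> + 1)) *\<^sub>C R y" for s y
  define M where "M s = 1 + cmod (\<i> * complex_of_real s - of_real (\<omega> + 1))" for s
  have M: "1 \<le> M s" for s by (simp add: M_def)
  have diff: "norm (Rn n y - R y) \<le> M s * norm (resolvent_at (An n) s (z s y) - resolvent_at A s (z s y))"
    if "s \<noteq> 0" for s n y
    unfolding R_def Rn_def z_def M_def
    by (rule shifted_resolvent_diff_le, rule assms, rule assms, erule belowA, erule belowAn, rule that)
  show ?thesis
  proof (intro conjI impI allI)
    fix t :: real assume "strong_resolvent_tendsto An A" and t: "0 < t"
    then obtain s where s: "s \<noteq> 0" and lim: "\<And>x. (\<lambda>n. resolvent_at (An n) s x) \<longlonglongrightarrow> resolvent_at A s x"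
      by (auto simp: strong_resolvent_tendsto_def strongly_tendsto_def)
    have "(\<lambda>n. Rn n y) \<longlonglongrightarrow> R y" for y
    proof (rule LIM_zero_cancel, rule Lim_null_comparison)
      show "\<forall>\<^sub>F n in sequentially. norm (Rn n y - R y)
          \<le> M s * norm (resolvent_at (An n) s (z s y) - resolvent_at A s (z s y))"
        using diff[OF s] by simp
      have "(\<lambda>n. M s * norm (resolvent_at (An n) s (z s y) - resolvent_at A s (z s y))) \<longlonglongrightarrow> M s * 0"
        by (intro tendsto_intros tendsto_norm_zero LIM_zero lim)
      then show "(\<lambda>n. M s * norm (resolvent_at (An n) s (z s y) - resolvent_at A s (z s y))) \<longlonglongrightarrow> 0"
        by simp
    qed
    then show "strongly_tendsto (\<lambda>n. graph_exp t (An n)) (graph_exp t A)"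
      unfolding strongly_tendsto_def exp[OF t] expn[OF t]
      by (auto intro!: bounded_clinear_calculus calculus_tendsto_strongly R Rn continuous_on_exp_symbol t)
  next
    fix t :: real
    assume *: "\<forall>s::real. s \<noteq> 0 \<longrightarrow> norm_tendsto (\<lambda>n. resolvent_at (An n) s) (resolvent_at A s)"
      and t: "0 < t"
    have res: "norm_tendsto (\<lambda>n. resolvent_at (An n) 1) (resolvent_at A 1)" using * by simp
    have bl: "bounded_linear (\<lambda>x. resolvent_at (An n) 1 x - resolvent_at A 1 x)" for n
      using res by (intro bounded_linear_sub) (auto simp: norm_tendsto_def bounded_clinear_def)
    have lim: "\<forall>\<^sub>F n in sequentially. \<forall>y. norm (Rn n y - R y) \<le> e * norm y" if "0 < e" for e
    proof -
      have M1: "0 < M 1" using M[of 1] by linarith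
      have "\<forall>\<^sub>F n in sequentially. onorm (\<lambda>x. resolvent_at (An n) 1 x - resolvent_at A 1 x) < e / (M 1 * M 1)"
        using res \<open>0 < e\<close> M1 by (intro order_tendstoD(2)[of _ 0]) (auto simp: norm_tendsto_def)
      then show ?thesis
      proof eventually_elim
        case (elim n)
        show ?case
        proof
          fix y
          have "norm (z 1 y) \<le> M 1 * norm y"
          proof -
            have "norm (z 1 y) \<le> norm y + (M 1 - 1) * norm (R y)"
              unfolding z_def M_def using norm_triangle_ineq[of y] by (metis add_diff_cancel_left' norm_scaleC)
            also have "\<dots> \<le> norm y + (M 1 - 1) * norm y"
              using M norm_positive_contraction_le[OF R] by (intro add_left_mono mult_left_mono) auto
            finally show ?thesis by (simp add: algebra_simps)
          qed
          then have "norm (resolvent_at (An n) 1 (z 1 y) - resolvent_at A 1 (z 1 y)) \<le> e / (M 1 * M 1) * (M 1 * norm y)"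
            using onorm[OF bl, of n "z 1 y"] elim \<open>0 < e\<close> M1
            by (elim order_trans) (intro mult_mono, auto)
          then have "M 1 * norm (resolvent_at (An n) 1 (z 1 y) - resolvent_at A 1 (z 1 y))
              \<le> M 1 * (e / (M 1 * M 1) * (M 1 * norm y))"
            using M1 by (intro mult_left_mono) auto
          also have "\<dots> = e * norm y" using M1 by (simp add: field_simps)
          finally show "norm (Rn n y - R y) \<le> e * norm y"
            using diff[of 1 n y] by linarith
        qed
      qed
    qed
    have bc: "bounded_clinear (calculus R (exp_symbol \<omega> t))" "bounded_clinear (calculus (Rn n) (exp_symbol \<omega> t))" for n
      by (intro bounded_clinear_calculus R Rn continuous_on_exp_symbol t)+
    have bl': "bounded_linear (\<lambda>x. calculus (Rn n) (exp_symbol \<omega> t) x - calculus R (exp_symbol \<omega> t) x)" for n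
      using bc by (intro bounded_linear_sub) (auto simp: bounded_clinear_def)
    have "(\<lambda>n. onorm (\<lambda>x. calculus (Rn n) (exp_symbol \<omega> t) x - calculus R (exp_symbol \<omega> t) x)) \<longlonglongrightarrow> 0"
    proof (rule tendstoI)
      fix e :: real assume "0 < e"
      then have "\<forall>\<^sub>F n in sequentially. \<forall>x. norm (calculus (Rn n) (exp_symbol \<omega> t) x - calculus R (exp_symbol \<omega> t) x)
          \<le> e / 2 * norm x"
        by (intro calculus_diff_eventually_le R Rn lim continuous_on_exp_symbol t) auto
      then show "\<forall>\<^sub>F n in sequentially.
          dist (onorm (\<lambda>x. calculus (Rn n) (exp_symbol \<omega> t) x - calculus R (exp_symbol \<omega> t) x)) 0 < e"
      proof eventually_elim
        case (elim n)
        then have "onorm (\<lambda>x. calculus (Rn n) (exp_symbol \<omega> t) x - calculus R (exp_symbol \<omega> t) x) \<le> e / 2"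
          using \<open>0 < e\<close> by (intro onorm_bound) auto
        then show ?case using onorm_pos_le[OF bl', of n] \<open>0 < e\<close> by (simp add: dist_real_def)
      qed
    qed
    then show "norm_tendsto (\<lambda>n. graph_exp t (An n)) (graph_exp t A)"
      unfolding norm_tendsto_def exp[OF t] expn[OF t] using bc by blast
  qed
qed

end
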